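(* (a) For every integer $n \geq 2$, every finite rank continuous $n$-linear operator $T \in \mathcal{L}(E_1,\ldots,E_n;F)$ between Banach spaces has cotype $1$. (b) Let $n \in \mathbb{N}$. The following holds: every finite rank continuous $n$-linear operator (between arbitrary Banach spaces $E_1,\ldots,E_n$ and $F$) has cotype $q$ for every proper cotype $q$ for $n$-linear operators (that is, for every $\frac{2}{n} \leq q < \infty$) if and only if $n=1$ or $n=2$.
   Context: All Banach spaces are over $\mathbb{K}=\mathbb{R}$ or $\mathbb{C}$; $\mathcal{L}(E_1,\ldots,E_n;F)$ is the space of continuous $n$-linear operators from $E_1\times\cdots\times E_n$ to $F$. Let $(r_j)_{j=1}^\infty$ be the Rademacher functions on $[0,1]$. For a finite sequence $(x_j)_{j=1}^k$ in a Banach space $E$ put $$\|(x_j)_{j=1}^k\|_{\mathrm{Rad}(E)} = \left(\int_0^1 \Big\| \sum_{j=1}^k r_j(t)x_j\Big\|^2 dt\right)^{1/2}.$$ For $0<q<\infty$, an operator $T \in \mathcal{L}(E_1,\ldots,E_n;F)$ has cotype $q$ if there is a constant $M>0$ such that for every $k\in\mathbb{N}$ and all $x_j^{(i)} \in E_i$ ($1\le i\le n$, $1\le j\le k$), $$\left(\sum_{j=1}^k \|T(x_j^{(1)},\ldots,x_j^{(n)})\|^q\right)^{1/q} \leq M \prod_{i=1}^n \|(x_j^{(i)})_{j=1}^k\|_{\mathrm{Rad}(E_i)}.$$ A proper cotype for $n$-linear operators is a number $q$ with $\frac{2}{n}\leq q<\infty$. A multilinear operator has finite rank if its range generates a finite-dimensional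 subspace of the target space. *)

theory Defs
  imports "HOL-Analysis.Analysis" "HOL-Algebra.Module"
begin

text \<open>
  By Frobenius' theorem every type of this class is isometrically isomorphic to \<open>real\<close> or \<open>complex\<close>:
  a finite-dimensional commutative real division algebra is R or C, and the modulus is its only
  multiplicative norm.
\<close>

class rc_field = real_normed_field + euclidean_space

instance real :: rc_field ..
instance complex :: rc_field ..

definition scalars :: "'k::field ring" where
  "scalars = \<lparr>carrier = UNIV, monoid.mult = (*), one = 1, zero = 0, add = (+)\<rparr>"

text \<open>
  A theorem has to quantify over several Banach spaces, which cannot be done with type classes, so
  a space is a record with an explicit carrier inside a type \<open>'a\<close>. Finitely many given spaces can be
  carried by one common type. A type of cardinality below the continuum carries only the zero
  spaces, so a statement that needs nontrivial spaces to exist needs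
  \<open>(UNIV :: real set) \<lesssim> (UNIV :: 'a set)\<close>. As usual for \<open>module\<close> records, the inherited ring
  multiplication and unit carry no meaning.
\<close>

record ('k, 'a) nvs = "('k, 'a) module" +
  vnorm :: "'a \<Rightarrow> real"

locale normed_vs = Module.module "scalars :: 'k::rc_field ring" X
  for X :: "('k::rc_field, 'a) nvs" (structure) +
  assumes vnorm_nonneg: "x \<in> carrier X \<Longrightarrow> 0 \<le> vnorm X x"
    and vnorm_eq_zero: "x \<in> carrier X \<Longrightarrow> vnorm X x = 0 \<longleftrightarrow> x = \<zero>\<^bsub>X\<^esub>"
    and vnorm_smult: "x \<in> carrier X \<Longrightarrow> vnorm X (c \<odot>\<^bsub>X\<^esub> x) = norm c * vnorm X x"
    and vnorm_triangle:
      "x \<in> carrier X \<Longrightarrow> y \<in> carrier X \<Longrightarrow> vnorm X (x \<oplus>\<^bsub>X\<^esub> y) \<le> vnorm X x + vnorm X y"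

text \<open>The value off the carrier is irrelevant, but \<open>Metric_space\<close> wants nonnegativity and symmetry
  on the whole type.\<close>

definition vdist :: "('k, 'a) nvs \<Rightarrow> 'a \<Rightarrow> 'a \<Rightarrow> real" where
  "vdist X x y = (if x \<in> carrier X \<and> y \<in> carrier X then vnorm X (x \<ominus>\<^bsub>X\<^esub> y) else 0)"

definition vtopology :: "('k, 'a) nvs \<Rightarrow> 'a topology" where
  "vtopology X = Metric_space.mtopology (carrier X) (vdist X)"

definition banach_space :: "('k::rc_field, 'a) nvs \<Rightarrow> bool" where
  "banach_space X \<longleftrightarrow> normed_vs X \<and> Metric_space.mcomplete (carrier X) (vdist X)"

text \<open>Vectors of \<open>E\<^sub>1 \<times> \<dots> \<times> E\<^sub>n\<close> are extensional functions on \<open>{1..n}\<close>.\<close>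

definition multilinear_op ::
  "nat \<Rightarrow> (nat \<Rightarrow> ('k, 'a) nvs) \<Rightarrow> ('k, 'b) nvs \<Rightarrow> ((nat \<Rightarrow> 'a) \<Rightarrow> 'b) \<Rightarrow> bool" where
  "multilinear_op n E F T \<longleftrightarrow>
     T \<in> (\<Pi>\<^sub>E i\<in>{1..n}. carrier (E i)) \<rightarrow> carrier F \<and>
     (\<forall>x \<in> (\<Pi>\<^sub>E i\<in>{1..n}. carrier (E i)). \<forall>i\<in>{1..n}. \<forall>u\<in>carrier (E i).
        (\<forall>v\<in>carrier (E i). T (x(i := u \<oplus>\<^bsub>E i\<^esub> v)) = T (x(i := u)) \<oplus>\<^bsub>F\<^esub> T (x(i := v))) \<and>
        (\<forall>c. T (x(i := c \<odot>\<^bsub>E i\<^esub> u)) = c \<odot>\<^bsub>F\<^esub> T (x(i := u))))"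

definition continuous_multilinear_ops ::
  "nat \<Rightarrow> (nat \<Rightarrow> ('k, 'a) nvs) \<Rightarrow> ('k, 'b) nvs \<Rightarrow> ((nat \<Rightarrow> 'a) \<Rightarrow> 'b) set" where
  "continuous_multilinear_ops n E F =
     {T. multilinear_op n E F T \<and>
         continuous_map (product_topology (\<lambda>i. vtopology (E i)) {1..n}) (vtopology F) T}"

definition lin_span :: "('k::field, 'a) nvs \<Rightarrow> 'a set \<Rightarrow> 'a set" where
  "lin_span X S = (\<lambda>H. Module.submodule H scalars X) hull S"

definition finite_rank ::
  "nat \<Rightarrow> (nat \<Rightarrow> ('k::field, 'a) nvs) \<Rightarrow> ('k, 'b) nvs \<Rightarrow> ((nat \<Rightarrow> 'a) \<Rightarrow> 'b) \<Rightarrow> bool" where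
  "finite_rank n E F T \<longleftrightarrow>
     (\<exists>B. finite B \<and> B \<subseteq> carrier F \<and>
          lin_span F (T ` (\<Pi>\<^sub>E i\<in>{1..n}. carrier (E i))) = lin_span F B)"

definition rademacher :: "nat \<Rightarrow> real \<Rightarrow> real" where
  "rademacher j t = sgn (sin (2 ^ j * pi * t))"

definition rad_norm :: "('k::rc_field, 'a) nvs \<Rightarrow> nat \<Rightarrow> (nat \<Rightarrow> 'a) \<Rightarrow> real"
  where
  "rad_norm X k x =
     sqrt (LBINT t:{0..1}. (vnorm X (\<Oplus>\<^bsub>X\<^esub>j\<in>{1..k}. of_real (rademacher j t) \<odot>\<^bsub>X\<^esub> x j))\<^sup>2)"

definition has_cotype ::
  "real \<Rightarrow> nat \<Rightarrow> (nat \<Rightarrow> ('k::rc_field, 'a) nvs) \<Rightarrow> ('k, 'b) nvs \<Rightarrow>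
   ((nat \<Rightarrow> 'a) \<Rightarrow> 'b) \<Rightarrow> bool" where
  "has_cotype q n E F T \<longleftrightarrow> 0 < q \<and>
     (\<exists>M>0. \<forall>k\<ge>1. \<forall>x. (\<forall>i\<in>{1..n}. \<forall>j\<in>{1..k}. x i j \<in> carrier (E i)) \<longrightarrow>
        (\<Sum>j=1..k. vnorm F (T (\<lambda>i\<in>{1..n}. x i j)) powr q) powr (1 / q)
          \<le> M * (\<Prod>i=1..n. rad_norm (E i) k (x i)))"

definition proper_cotype :: "nat \<Rightarrow> real \<Rightarrow> bool" where
  "proper_cotype n q \<longleftrightarrow> 2 / real n \<le> q"

lemma scalars_cring: "cring (scalars :: 'k::field ring)"
proof -
  have "\<exists>y. y + x = 0 \<and> x + y = 0" for x :: 'k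
    by (rule exI[of _ "- x"]) simp
  then show ?thesis
    by (unfold_locales) (auto simp: scalars_def algebra_simps Units_def)
qed

lemma (in normed_vs) Metric_space_vdist: "Metric_space (carrier X) (vdist X)"
proof -
  have minus1: "\<ominus>\<^bsub>X\<^esub> x = (- 1 :: 'k) \<odot>\<^bsub>X\<^esub> x" if x: "x \<in> carrier X" for x
  proof -
    have "(- 1 :: 'k) \<odot>\<^bsub>X\<^esub> x \<oplus>\<^bsub>X\<^esub> x = (- 1 + 1 :: 'k) \<odot>\<^bsub>X\<^esub> x"
      using smult_l_distr[of "-1::'k" 1 x] smult_one[OF x] x by (simp add: scalars_def)
    also have "\<dots> = \<zero>\<^bsub>X\<^esub>"
      using smult_l_null[OF x] by (simp add: scalars_def)
    finally show ?thesis
      using x by (intro M.minus_equality) (auto simp: scalars_def)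
  qed
  have swap: "vnorm X (x \<ominus>\<^bsub>X\<^esub> y) = vnorm X (y \<ominus>\<^bsub>X\<^esub> x)"
    if x: "x \<in> carrier X" and y: "y \<in> carrier X" for x y
  proof -
    have "y \<ominus>\<^bsub>X\<^esub> x = \<ominus>\<^bsub>X\<^esub> (x \<ominus>\<^bsub>X\<^esub> y)"
      using x y by (simp add: a_minus_def M.minus_add M.a_comm)
    then show ?thesis
      using x y by (simp add: minus1[of "x \<ominus>\<^bsub>X\<^esub> y"] vnorm_smult)
  qed
  have split: "x \<ominus>\<^bsub>X\<^esub> z = (x \<ominus>\<^bsub>X\<^esub> y) \<oplus>\<^bsub>X\<^esub> (y \<ominus>\<^bsub>X\<^esub> z)"
    if "x \<in> carrier X" "y \<in> carrier X" "z \<in> carrier X" for x y z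
    using that by (simp add: a_minus_def M.a_assoc M.r_neg1)
  show ?thesis
  proof
    fix x y
    show "0 \<le> vdist X x y"
      by (simp add: vdist_def vnorm_nonneg)
    show "vdist X x y = vdist X y x"
      by (simp add: vdist_def swap)
  next
    fix x y assume xy: "x \<in> carrier X" "y \<in> carrier X"
    then have "x \<ominus>\<^bsub>X\<^esub> y = \<zero>\<^bsub>X\<^esub> \<longleftrightarrow> x = y"
      using M.minus_equality[of x "\<ominus>\<^bsub>X\<^esub> y"] by (auto simp: a_minus_def M.r_neg)
    then show "vdist X x y = 0 \<longleftrightarrow> x = y"
      using xy by (simp add: vdist_def vnorm_eq_zero)
  next
    fix x y z assume "x \<in> carrier X" "y \<in> carrier X" "z \<in> carrier X"
    then show "vdist X x z \<le> vdist X x y + vdist X y z"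
      by (simp add: vdist_def split[of x y z] vnorm_triangle)
  qed
qed

end

theory Submission
  imports Defs
begin

text \<open>
  Rademacher averages are averages over the sign vectors \<open>s \<in> {-1, 1}\<^sup>k\<close>. A finite rank operator is
  dominated by finitely many real-valued, bounded, additive forms, because the coordinates on a
  finite-dimensional normed space are bounded. For a bilinear form \<open>B\<close> and a suitable choice of
  signs \<open>\<sigma> j\<close>, the sum of \<open>\<bar>B (x j) (y j)\<bar>\<close> is the average of
  \<open>B (\<Sum>j. \<sigma> j * s j * x j) (\<Sum>j. s j * y j)\<close>, and the Cauchy-Schwarz inequality gives
  cotype 1, since the factors \<open>\<sigma> j\<close> do not change the distribution of the first argument. A further
  variable is replaced by its random sum \<open>\<Sum>j. s j * z j\<close>, which reduces forms of degree \<open>n + 1\<close> to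
  degree \<open>n\<close>. For linear forms the same orthogonality yields cotype 2.

  For \<open>n \<ge> 3\<close> the form \<open>\<Sum>m. x\<^sub>1 m * \<dots> * x\<^sub>n m\<close> on \<open>l\<^sup>1 \<times> l\<^sup>\<infinity> \<times> \<dots> \<times> l\<^sup>\<infinity>\<close>, tested on the unit vectors
  \<open>e 1, \<dots>, e k\<close> in every variable, has value 1 at each of them, while the Rademacher norms are at most
  \<open>k\<close> in the first variable and 1 in the others. Hence cotype \<open>q\<close> forces \<open>q \<ge> 1 > 2 / n\<close>.
\<close>

section \<open>Rademacher averages\<close>

text \<open>The forms are kept real-valued and merely additive in each variable. Over the complex
  field the coordinates of the range are split into real and imaginary parts; this destroys complex
  homogeneity but keeps additivity, and additivity already governs the coefficients 1 and -1. So
  real signs can turn values into absolute values, and both fields are treated at once. Degree 2 is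
  where the induction has to start: two quadratic means meet in one Cauchy-Schwarz inequality,
  whereas a single linear form controls only a sum of squares. In the counterexample one factor must
  be summable, since this makes the diagonal series converge. It is also the only factor whose norm
  bound grows with \<open>k\<close>, so the product of the norms is at most \<open>k\<close> in
  every degree, while the exponent \<open>2 / n\<close> falls below 1. The sequence spaces must live
  inside the given type, so they are transported along an injection of all scalar sequences into it;
  this is where the cardinality of the type enters.\<close>

definition signs :: "nat \<Rightarrow> (nat \<Rightarrow> real) set" where
  "signs k = (\<Pi>\<^sub>E j\<in>{1..k}. {-1, 1})"

lemma finite_signs [simp]: "finite (signs k)"
  by (auto simp: signs_def intro: finite_PiE)

lemma card_signs: "card (signs k) = 2 ^ k"
  by (simp add: signs_def card_PiE numeral_2_eq_2)

lemma signs_cases: "s \<in> signs k \<Longrightarrow> j \<in> {1..k} \<Longrightarrow> s j = 1 \<or> s j = -1"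
  by (auto simp: signs_def)

lemma signs_square: "s \<in> signs k \<Longrightarrow> j \<in> {1..k} \<Longrightarrow> s j * s j = 1"
  using signs_cases by fastforce

text \<open>The first sign is split off, and not the last, because doubling the argument of a
  Rademacher function lowers its index: the induction over \<open>k\<close> for the functions
  themselves removes index 1 and shifts the others down.\<close>

lemma sum_signs_Suc:
  "(\<Sum>s\<in>signs (Suc k). H s) =
   (\<Sum>s\<in>signs k. H (\<lambda>j\<in>{1..Suc k}. if j = 1 then 1 else s (j - 1))
               + H (\<lambda>j\<in>{1..Suc k}. if j = 1 then -1 else s (j - 1)))"
  for H :: "(nat \<Rightarrow> real) \<Rightarrow> real"
proof -
  let ?c = "\<lambda>e s. \<lambda>j\<in>{1..Suc k}. if j = 1 then e else (s :: nat \<Rightarrow> real) (j - 1)"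
  have "(\<Sum>s\<in>signs (Suc k). H s) = (\<Sum>(e, s)\<in>{1, -1} \<times> signs k. H (?c e s))"
  proof (rule sum.reindex_bij_witness[where j = "\<lambda>s. (s 1, \<lambda>j\<in>{1..k}. s (Suc j))"
        and i = "\<lambda>(e, s). ?c e s"], goal_cases)
    case (1 s)
    have "?c (s 1) (\<lambda>j\<in>{1..k}. s (Suc j)) j = s j" for j
      using 1 by (cases j) (auto simp: signs_def PiE_def extensional_def)
    then have "?c (s 1) (\<lambda>j\<in>{1..k}. s (Suc j)) = s" by blast
    then show ?case by (simp del: One_nat_def)
  next
    case (2 s)
    then show ?case by (auto simp: signs_def PiE_def Pi_def)
  next
    case (3 b)
    then show ?case
      by (auto simp: signs_def PiE_def extensional_def fun_eq_iff)
  next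
    case (4 b)
    obtain e s where b: "b = (e, s)" by (cases b)
    have "?c e s j \<in> {-1, 1}" if "j \<in> {1..Suc k}" for j
      using 4 that signs_cases[of s k "j - 1"] by (cases "j = 1") (auto simp: b Suc_le_eq)
    then show ?case by (simp add: b signs_def)
  next
    case (5 s)
    have "?c (s 1) (\<lambda>j\<in>{1..k}. s (Suc j)) j = s j" for j
      using 5 by (cases j) (auto simp: signs_def PiE_def extensional_def)
    then have "?c (s 1) (\<lambda>j\<in>{1..k}. s (Suc j)) = s" by blast
    then show ?case by (simp del: One_nat_def)
  qed
  then show ?thesis
    by (simp add: sum.cartesian_product[symmetric] sum.distrib)
qed

text \<open>Coordinatewise multiplication by a fixed sign vector is an involution of
  \<open>signs k\<close>.\<close>

lemma sum_signs_flip: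
  fixes H :: "(nat \<Rightarrow> real) \<Rightarrow> real"
  assumes "\<sigma> \<in> signs k"
  shows "(\<Sum>s\<in>signs k. H (\<lambda>j\<in>{1..k}. \<sigma> j * s j)) = (\<Sum>s\<in>signs k. H s)"
proof -
  let ?m = "\<lambda>s. \<lambda>j\<in>{1..k}. \<sigma> j * s j"
  have inv: "?m (?m s) = s" if "s \<in> signs k" for s
  proof
    fix j show "?m (?m s) j = s j"
      using signs_square[OF assms, of j] that
      by (cases "j \<in> {1..k}") (auto simp: signs_def PiE_def extensional_def simp flip: mult.assoc)
  qed
  have cl: "?m s \<in> signs k" if "s \<in> signs k" for s
    using assms that by (fastforce simp: signs_def PiE_def Pi_def)
  show ?thesis
    by (rule sum.reindex_bij_witness[of _ ?m ?m]) (use inv cl in auto)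
qed

text \<open>For \<open>i \<noteq> j\<close>, flipping only the sign at \<open>i\<close> negates the
  sum without changing it, so it vanishes.\<close>

lemma signs_orthogonal:
  assumes "i \<in> {1..k}" "j \<in> {1..k}"
  shows "(\<Sum>s\<in>signs k. s i * s j) = (if i = j then 2 ^ k else 0)"
proof (cases "i = j")
  case True
  then show ?thesis using assms by (simp add: signs_square card_signs)
next
  case False
  let ?\<sigma> = "\<lambda>l\<in>{1..k}. if l = i then -1 else (1::real)"
  have "?\<sigma> \<in> signs k" by (auto simp: signs_def)
  from sum_signs_flip[OF this, of "\<lambda>s. s i * s j"] show ?thesis
    using assms False by (simp add: sum_negf)
qed

section \<open>Joint distribution of the Rademacher functions\<close>

lemma rademacher_Suc: "rademacher (Suc j) t = rademacher j (2 * t)"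
  by (simp add: rademacher_def mult_ac)

text \<open>Period 1, which carries the right half of the interval back to \<open>{0..1}\<close>
  after doubling. For \<open>j = 0\<close> the argument of the sine would move by only half a
  period.\<close>

lemma rademacher_minus_1:
  assumes "1 \<le> j"
  shows "rademacher j (t - 1) = rademacher j t"
proof -
  have "2 ^ j * pi * t = 2 ^ j * pi * (t - 1) + of_nat (2 ^ (j - 1)) * (2 * pi)"
    using assms by (cases j) (simp_all add: algebra_simps)
  then show ?thesis
    using sin.plus_of_nat[of "2 ^ j * pi * (t - 1)" "2 ^ (j - 1)"]
    by (simp only: rademacher_def of_real_eq_id id_apply)
qed

lemma rademacher_1_pos: "0 < t \<Longrightarrow> t < 1 / 2 \<Longrightarrow> rademacher 1 t = 1"
  unfolding rademacher_def using sin_gt_zero[of "2 * pi * t"] by (simp add: sgn_if)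

lemma rademacher_1_neg: "1 / 2 < t \<Longrightarrow> t < 1 \<Longrightarrow> rademacher 1 t = -1"
  unfolding rademacher_def using sin_lt_zero[of "2 * pi * t"] by (simp add: sgn_if)

text \<open>The first \<open>k\<close> Rademacher functions take every sign vector on a set of
  measure \<open>1 / 2 ^ k\<close>. On the left half of the interval the first function is 1, on the
  right half it is -1, and on each half the remaining ones are a compressed copy of the first
  \<open>k\<close>.\<close>

lemma has_bochner_integral_rademacher:
  fixes H :: "(nat \<Rightarrow> real) \<Rightarrow> real"
  shows "has_bochner_integral lborel (\<lambda>t. indicator {0..1} t * H (\<lambda>j\<in>{1..k}. rademacher j t))
           ((\<Sum>s\<in>signs k. H s) / 2 ^ k)"
proof (induction k arbitrary: H)
  case 0
  have "has_bochner_integral lborel (\<lambda>t::real. indicator {0..1} t *\<^sub>R H (\<lambda>_. undefined)) (1 *\<^sub>R H (\<lambda>_. undefined))"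
    using has_bochner_integral_real_indicator[of "{0..1}" "lborel :: real measure"]
    by (intro has_bochner_integral_scaleR_left) simp
  then show ?case by (simp add: signs_def restrict_def)
next
  case (Suc k)
  define c where "c e s = (\<lambda>j\<in>{1..Suc k}. if j = 1 then e else s (j - 1))" for e and s :: "nat \<Rightarrow> real"
  define f where "f e t = indicator {0..1} t * H (c e (\<lambda>j\<in>{1..k}. rademacher j t))" for e t :: real
  define I where "I e = (\<Sum>s\<in>signs k. H (c e s)) / 2 ^ k" for e
  have f: "has_bochner_integral lborel (f e) (I e)" for e
    unfolding f_def I_def by (rule Suc.IH)
  \<comment> \<open>The substitutions \<open>2 * t\<close> and \<open>2 * t - 1\<close> stretch the
    two halves to \<open>{0..1}\<close>; each contributes the factor 1/2 that turns
    \<open>2 ^ k\<close> into \<open>2 ^ Suc k\<close>.\<close>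
  have "has_bochner_integral lborel (\<lambda>t. f 1 (0 + 2 * t)) (I 1 /\<^sub>R \<bar>2\<bar>)"
    by (subst lborel_has_bochner_integral_real_affine_iff[of 2, symmetric]) (use f in auto)
  moreover have "has_bochner_integral lborel (\<lambda>t. f (-1) (-1 + 2 * t)) (I (-1) /\<^sub>R \<bar>2\<bar>)"
    by (subst lborel_has_bochner_integral_real_affine_iff[of 2, symmetric]) (use f in auto)
  ultimately have "has_bochner_integral lborel (\<lambda>t. f 1 (0 + 2 * t) + f (-1) (-1 + 2 * t))
      (I 1 /\<^sub>R \<bar>2\<bar> + I (-1) /\<^sub>R \<bar>2\<bar>)"
    by (rule has_bochner_integral_add)
  also have "I 1 /\<^sub>R \<bar>2\<bar> + I (-1) /\<^sub>R \<bar>2\<bar> = (\<Sum>s\<in>signs (Suc k). H s) / 2 ^ Suc k"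
    by (simp add: sum_signs_Suc I_def c_def sum.distrib field_simps)
  finally have g: "has_bochner_integral lborel (\<lambda>t. f 1 (0 + 2 * t) + f (-1) (-1 + 2 * t)) \<dots>" .
  \<comment> \<open>At the three excluded points the first Rademacher function is 0, which is not a
    sign, and at 1/2 both copies are present. They form a null set.\<close>
  have eq: "indicator {0..1} t * H (\<lambda>j\<in>{1..Suc k}. rademacher j t) = f 1 (0 + 2 * t) + f (-1) (-1 + 2 * t)"
    if t: "t \<notin> {0, 1/2, 1}" for t
  proof -
    consider "t < 0" | "0 < t" "t < 1/2" | "1/2 < t" "t < 1" | "1 < t"
      using t by force
    then show ?thesis
    proof cases
      case 2
      have "(\<lambda>j\<in>{1..Suc k}. rademacher j t) = c 1 (\<lambda>j\<in>{1..k}. rademacher j (2 * t))"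
        using rademacher_1_pos[OF 2] 
        by (auto simp: c_def fun_eq_iff restrict_def rademacher_Suc[symmetric])
      then show ?thesis using 2 by (simp add: f_def)
    next
      case 3
      have "(\<lambda>j\<in>{1..Suc k}. rademacher j t) = c (-1) (\<lambda>j\<in>{1..k}. rademacher j (2 * t - 1))"
        using rademacher_1_neg[OF 3] 
        by (auto simp: c_def fun_eq_iff restrict_def rademacher_Suc[symmetric] rademacher_minus_1)
      then show ?thesis using 3 by (simp add: f_def)
    qed (auto simp: f_def)
  qed
  show ?case
    by (rule has_bochner_integral_discrete_difference[where X = "{0, 1/2, 1}", THEN iffD2, OF _ _ _ eq g])
      auto
qed

section \<open>Random sums and their quadratic means\<close>

definition sign_sum :: "('k::rc_field, 'a) nvs \<Rightarrow> nat \<Rightarrow> (nat \<Rightarrow> 'a) \<Rightarrow> (nat \<Rightarrow> real) \<Rightarrow> 'a" where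
  "sign_sum X k x s = (\<Oplus>\<^bsub>X\<^esub>j\<in>{1..k}. of_real (s j) \<odot>\<^bsub>X\<^esub> x j)"

lemma carrier_scalars [simp]: "c \<in> carrier scalars"
  by (simp add: scalars_def)

context normed_vs
begin

lemma sign_sum_closed: "(\<And>j. j \<in> {1..k} \<Longrightarrow> x j \<in> carrier X) \<Longrightarrow> sign_sum X k x s \<in> carrier X"
  unfolding sign_sum_def by (intro M.finsum_closed) auto

lemma sign_sum_cong:
  "(\<And>j. j \<in> {1..k} \<Longrightarrow> x j \<in> carrier X) \<Longrightarrow> (\<And>j. j \<in> {1..k} \<Longrightarrow> s j = s' j) \<Longrightarrow>
   sign_sum X k x s = sign_sum X k x s'"
  unfolding sign_sum_def by (intro M.finsum_cong') auto

lemma rad_norm_eq: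
  assumes "\<And>j. j \<in> {1..k} \<Longrightarrow> x j \<in> carrier X"
  shows "rad_norm X k x = sqrt ((\<Sum>s\<in>signs k. (vnorm X (sign_sum X k x s))\<^sup>2) / 2 ^ k)"
proof -
  have "sign_sum X k x (\<lambda>j\<in>{1..k}. rademacher j t) = sign_sum X k x (\<lambda>j. rademacher j t)" for t
    by (rule sign_sum_cong) (use assms in auto)
  then show ?thesis
    using has_bochner_integral_rademacher[of "\<lambda>s. (vnorm X (sign_sum X k x s))\<^sup>2" k,
        THEN has_bochner_integral_integral_eq]
    by (simp add: rad_norm_def set_lebesgue_integral_def sign_sum_def)
qed

lemma rad_norm_nonneg: "(\<And>j. j \<in> {1..k} \<Longrightarrow> x j \<in> carrier X) \<Longrightarrow> 0 \<le> rad_norm X k x"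
  by (subst rad_norm_eq) (auto intro!: sum_nonneg divide_nonneg_nonneg)

text \<open>Additivity gives \<open>f \<zero> = 0\<close> and hence the value at the negative of a
  vector, which is all the homogeneity that coefficients 1 and -1 ask for.\<close>

lemma additive_sign_sum:
  fixes f :: "'a \<Rightarrow> real"
  assumes x: "\<And>j. j \<in> {1..k} \<Longrightarrow> x j \<in> carrier X" and s: "s \<in> signs k"
    and add: "\<And>u v. u \<in> carrier X \<Longrightarrow> v \<in> carrier X \<Longrightarrow> f (u \<oplus> v) = f u + f v"
  shows "f (sign_sum X k x s) = (\<Sum>j=1..k. s j * f (x j))"
proof -
  have zero: "f \<zero> = 0" using add[of \<zero> \<zero>] by simp
  have one: "f (of_real (s j) \<odot> x j) = s j * f (x j)" if j: "j \<in> {1..k}" for j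
  proof -
    have 1: "(1::'k) \<odot> x j = x j" using smult_one[OF x[OF j]] by (simp add: scalars_def)
    have "f ((-1::'k) \<odot> x j) + f ((1::'k) \<odot> x j) = f (((-1::'k) + 1) \<odot> x j)"
      using add[of "(-1::'k) \<odot> x j" "(1::'k) \<odot> x j"] smult_l_distr[of "-1::'k" 1 "x j"] x[OF j]
      by (simp add: scalars_def smult_closed)
    also have "\<dots> = 0"
      using smult_l_null[OF x[OF j]] zero by (simp add: scalars_def)
    finally show ?thesis using signs_cases[OF s j] 1 by auto
  qed
  have "f (\<Oplus>j\<in>A. g j) = (\<Sum>j\<in>A. f (g j))" if "finite A" "g \<in> A \<rightarrow> carrier X" for A and g :: "nat \<Rightarrow> 'a"
    using that by (induction A rule: finite_induct) (simp_all add: zero add M.finsum_insert)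
  from this[of "{1..k}" "\<lambda>j. of_real (s j) \<odot> x j"] show ?thesis
    using x one by (simp add: sign_sum_def Pi_def)
qed

end

section \<open>Cotype inequalities for real-valued additive forms\<close>

lemma sum_abs_biadditive_le:
  fixes B :: "'a \<Rightarrow> 'b \<Rightarrow> real" and X :: "('k::rc_field, 'a) nvs" and Y :: "('k, 'b) nvs"
  assumes X: "normed_vs X" and Y: "normed_vs Y"
    and addX: "\<And>u v w. u \<in> carrier X \<Longrightarrow> v \<in> carrier X \<Longrightarrow> w \<in> carrier Y \<Longrightarrow>
                 B (u \<oplus>\<^bsub>X\<^esub> v) w = B u w + B v w"
    and addY: "\<And>u v w. u \<in> carrier X \<Longrightarrow> v \<in> carrier Y \<Longrightarrow> w \<in> carrier Y \<Longrightarrow>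
                 B u (v \<oplus>\<^bsub>Y\<^esub> w) = B u v + B u w"
    and bd: "\<And>u v. u \<in> carrier X \<Longrightarrow> v \<in> carrier Y \<Longrightarrow> \<bar>B u v\<bar> \<le> C * (vnorm X u * vnorm Y v)"
    and C: "0 \<le> C"
    and x: "\<And>j. j \<in> {1..k} \<Longrightarrow> x j \<in> carrier X" and y: "\<And>j. j \<in> {1..k} \<Longrightarrow> y j \<in> carrier Y"
  shows "(\<Sum>j=1..k. \<bar>B (x j) (y j)\<bar>) \<le> C * (rad_norm X k x * rad_norm Y k y)"
proof -
  interpret X: normed_vs X by fact
  interpret Y: normed_vs Y by fact
  define \<sigma> where "\<sigma> = (\<lambda>j\<in>{1..k}. if B (x j) (y j) < 0 then -1 else (1::real))"
  have \<sigma>: "\<sigma> \<in> signs k" by (auto simp: \<sigma>_def signs_def)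
  define m where "m s = (\<lambda>j\<in>{1..k}. \<sigma> j * s j)" for s
  have m: "m s \<in> signs k" if "s \<in> signs k" for s
    using \<sigma> that by (fastforce simp: m_def signs_def PiE_def Pi_def)
  define nX where "nX s = vnorm X (sign_sum X k x s)" for s
  define nY where "nY s = vnorm Y (sign_sum Y k y s)" for s
  have rX: "rad_norm X k x = sqrt ((\<Sum>s\<in>signs k. (nX s)\<^sup>2) / 2 ^ k)"
    unfolding nX_def by (rule X.rad_norm_eq) (use x in auto)
  have rY: "rad_norm Y k y = sqrt ((\<Sum>s\<in>signs k. (nY s)\<^sup>2) / 2 ^ k)"
    unfolding nY_def by (rule Y.rad_norm_eq) (use y in auto)
  note clX = X.sign_sum_closed[of k x, OF x] and clY = Y.sign_sum_closed[of k y, OF y]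
  \<comment> \<open>Orthogonality leaves only the terms with \<open>l = j\<close>, and there
    \<open>\<sigma> j\<close> is the sign of the value.\<close>
  have "2 ^ k * (\<Sum>j=1..k. \<bar>B (x j) (y j)\<bar>)
      = (\<Sum>j=1..k. \<Sum>l=1..k. (\<Sum>s\<in>signs k. s j * s l) * (\<sigma> j * B (x j) (y l)))"
    by (simp add: signs_orthogonal sum_distrib_left \<sigma>_def if_distrib[of "\<lambda>x. x * _"] cong: if_cong)
      (intro sum.cong, auto simp: \<sigma>_def)
  also have "\<dots> = (\<Sum>j=1..k. \<Sum>l=1..k. \<Sum>s\<in>signs k. s j * s l * (\<sigma> j * B (x j) (y l)))"
    by (simp add: sum_distrib_right)
  also have "\<dots> = (\<Sum>j=1..k. \<Sum>s\<in>signs k. \<Sum>l=1..k. s j * s l * (\<sigma> j * B (x j) (y l)))"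
    by (intro sum.cong sum.swap refl)
  also have "\<dots> = (\<Sum>s\<in>signs k. \<Sum>j=1..k. \<Sum>l=1..k. s j * s l * (\<sigma> j * B (x j) (y l)))"
    by (rule sum.swap)
  also have "\<dots> = (\<Sum>s\<in>signs k. B (sign_sum X k x (m s)) (sign_sum Y k y s))"
  proof (intro sum.cong refl)
    fix s assume s: "s \<in> signs k"
    have "B (sign_sum X k x (m s)) (sign_sum Y k y s) = (\<Sum>j=1..k. m s j * B (x j) (sign_sum Y k y s))"
      by (rule X.additive_sign_sum) (use x m s addX clY in auto)
    also have "\<dots> = (\<Sum>j=1..k. m s j * (\<Sum>l=1..k. s l * B (x j) (y l)))"
      by (intro sum.cong refl arg_cong2[of _ _ _ _ times] Y.additive_sign_sum) (use x y s addY in auto)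
    also have "\<dots> = (\<Sum>j=1..k. \<Sum>l=1..k. s j * s l * (\<sigma> j * B (x j) (y l)))"
      by (simp add: sum_distrib_left m_def mult_ac)
    finally show "(\<Sum>j=1..k. \<Sum>l=1..k. s j * s l * (\<sigma> j * B (x j) (y l)))
        = B (sign_sum X k x (m s)) (sign_sum Y k y s)" by simp
  qed
  also have "\<dots> \<le> (\<Sum>s\<in>signs k. C * (nX (m s) * nY s))"
    unfolding nX_def nY_def by (rule sum_mono, rule abs_le_D1, rule bd[OF clX clY])
  also have "\<dots> = C * (\<Sum>s\<in>signs k. nX (m s) * nY s)"
    by (simp add: sum_distrib_left)
  also have "\<dots> \<le> C * (2 ^ k * (rad_norm X k x * rad_norm Y k y))"
  proof (rule mult_left_mono[OF _ C])
    have "(\<Sum>s\<in>signs k. nX (m s) * nY s) \<le> sqrt (\<Sum>s\<in>signs k. (nX (m s))\<^sup>2) * sqrt (\<Sum>s\<in>signs k. (nY s)\<^sup>2)"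
      using real_le_rsqrt[OF Cauchy_Schwarz_ineq_sum[of "\<lambda>s. nX (m s)" nY "signs k"]]
      by (simp add: real_sqrt_mult)
    also have "(\<Sum>s\<in>signs k. (nX (m s))\<^sup>2) = (\<Sum>s\<in>signs k. (nX s)\<^sup>2)"
      unfolding m_def by (rule sum_signs_flip[OF \<sigma>, of "\<lambda>s. (nX s)\<^sup>2"])
    also have "sqrt (\<Sum>s\<in>signs k. (nX s)\<^sup>2) * sqrt (\<Sum>s\<in>signs k. (nY s)\<^sup>2)
        = 2 ^ k * (rad_norm X k x * rad_norm Y k y)"
      by (simp add: rX rY real_sqrt_divide)
    finally show "(\<Sum>s\<in>signs k. nX (m s) * nY s) \<le> 2 ^ k * (rad_norm X k x * rad_norm Y k y)" .
  qed
  finally have "2 ^ k * (\<Sum>j=1..k. \<bar>B (x j) (y j)\<bar>) \<le> 2 ^ k * (C * (rad_norm X k x * rad_norm Y k y))"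
    by (simp add: mult_ac)
  then show ?thesis by simp
qed

text \<open>Parseval's identity: the sum of squares is the mean of the squared value of
  \<open>f\<close> at the random sum, and there the bound on \<open>f\<close> applies
  pointwise.\<close>

lemma sum_sq_additive_le:
  fixes f :: "'a \<Rightarrow> real" and X :: "('k::rc_field, 'a) nvs"
  assumes X: "normed_vs X"
    and add: "\<And>u v. u \<in> carrier X \<Longrightarrow> v \<in> carrier X \<Longrightarrow> f (u \<oplus>\<^bsub>X\<^esub> v) = f u + f v"
    and bd: "\<And>u. u \<in> carrier X \<Longrightarrow> \<bar>f u\<bar> \<le> C * vnorm X u"
    and x: "\<And>j. j \<in> {1..k} \<Longrightarrow> x j \<in> carrier X"
  shows "(\<Sum>j=1..k. (f (x j))\<^sup>2) \<le> (C * rad_norm X k x)\<^sup>2"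
proof -
  interpret X: normed_vs X by fact
  have "2 ^ k * (\<Sum>j=1..k. (f (x j))\<^sup>2)
      = (\<Sum>j=1..k. \<Sum>l=1..k. (\<Sum>s\<in>signs k. s j * s l) * (f (x j) * f (x l)))"
    by (simp add: signs_orthogonal sum_distrib_left power2_eq_square if_distrib[of "\<lambda>x. x * _"] cong: if_cong)
  also have "\<dots> = (\<Sum>j=1..k. \<Sum>l=1..k. \<Sum>s\<in>signs k. s j * s l * (f (x j) * f (x l)))"
    by (simp add: sum_distrib_right)
  also have "\<dots> = (\<Sum>j=1..k. \<Sum>s\<in>signs k. \<Sum>l=1..k. s j * s l * (f (x j) * f (x l)))"
    by (intro sum.cong sum.swap refl)
  also have "\<dots> = (\<Sum>s\<in>signs k. \<Sum>j=1..k. \<Sum>l=1..k. s j * s l * (f (x j) * f (x l)))"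
    by (rule sum.swap)
  also have "\<dots> = (\<Sum>s\<in>signs k. (f (sign_sum X k x s))\<^sup>2)"
  proof (intro sum.cong refl)
    fix s assume "s \<in> signs k"
    then have "f (sign_sum X k x s) = (\<Sum>j=1..k. s j * f (x j))"
      by (intro X.additive_sign_sum x add)
    then show "(\<Sum>j=1..k. \<Sum>l=1..k. s j * s l * (f (x j) * f (x l))) = (f (sign_sum X k x s))\<^sup>2"
      by (simp add: power2_eq_square sum_product mult_ac)
  qed
  also have "\<dots> \<le> (\<Sum>s\<in>signs k. C\<^sup>2 * (vnorm X (sign_sum X k x s))\<^sup>2)"
    unfolding power_mult_distrib[symmetric]
    by (intro sum_mono abs_le_square_iff[THEN iffD1] order.trans[OF bd] X.sign_sum_closed x) auto
  also have "\<dots> = 2 ^ k * (C * rad_norm X k x)\<^sup>2"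
  proof -
    have "rad_norm X k x = sqrt ((\<Sum>s\<in>signs k. (vnorm X (sign_sum X k x s))\<^sup>2) / 2 ^ k)"
      by (rule X.rad_norm_eq) (use x in auto)
    then show ?thesis
      by (simp add: power_mult_distrib sum_nonneg flip: sum_distrib_left)
  qed
  finally show ?thesis by simp
qed

text \<open>Stated without scalars, because the real coordinates of a complex multilinear operator
  are additive in each variable but not complex homogeneous.\<close>

definition multiadditive ::
  "nat \<Rightarrow> (nat \<Rightarrow> ('k, 'a) nvs) \<Rightarrow> ((nat \<Rightarrow> 'a) \<Rightarrow> real) \<Rightarrow> bool" where
  "multiadditive n E \<phi> \<longleftrightarrow>
     (\<forall>x \<in> (\<Pi>\<^sub>E i\<in>{1..n}. carrier (E i)). \<forall>i\<in>{1..n}. \<forall>u\<in>carrier (E i). \<forall>v\<in>carrier (E i).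
        \<phi> (x(i := u \<oplus>\<^bsub>E i\<^esub> v)) = \<phi> (x(i := u)) + \<phi> (x(i := v)))"

text \<open>Each value is the mean over \<open>s\<close> of \<open>s j\<close> times the form whose
  last variable is frozen at the random sum \<open>X s\<close>. Freezing costs the factor
  \<open>vnorm (E (Suc n)) (X s)\<close>, and the mean of these norms is bounded by their quadratic
  mean, the Rademacher norm of the last variable.\<close>

lemma sum_abs_multiadditive_le:
  fixes E :: "nat \<Rightarrow> ('k::rc_field, 'a) nvs"
  assumes "2 \<le> n" and "\<And>i. i \<in> {1..n} \<Longrightarrow> normed_vs (E i)" and "multiadditive n E \<phi>"
    and "\<And>x. x \<in> (\<Pi>\<^sub>E i\<in>{1..n}. carrier (E i)) \<Longrightarrow> \<bar>\<phi> x\<bar> \<le> C * (\<Prod>i=1..n. vnorm (E i) (x i))"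
    and "0 \<le> C"
    and "\<And>i j. i \<in> {1..n} \<Longrightarrow> j \<in> {1..k} \<Longrightarrow> x i j \<in> carrier (E i)"
  shows "(\<Sum>j=1..k. \<bar>\<phi> (\<lambda>i\<in>{1..n}. x i j)\<bar>) \<le> C * (\<Prod>i=1..n. rad_norm (E i) k (x i))"
  using assms
proof (induction n arbitrary: \<phi> C rule: nat_induct_at_least)
  case base
  define p :: "'a \<Rightarrow> 'a \<Rightarrow> nat \<Rightarrow> 'a" where "p u v = (\<lambda>i\<in>{1..2}. if i = 1 then u else v)" for u v
  have set2: "{1..2::nat} = {1, 2}" by auto
  have p: "p u v \<in> (\<Pi>\<^sub>E i\<in>{1..2}. carrier (E i))" if "u \<in> carrier (E 1)" "v \<in> carrier (E 2)" for u v
    using that unfolding p_def set2 by auto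
  have p1: "(p u v)(1 := u') = p u' v" and p2: "(p u v)(2 := v') = p u v'" for u v u' v'
    by (auto simp: p_def fun_eq_iff)
  have p12: "p u v 1 = u" "p u v 2 = v" for u v
    by (auto simp: p_def)
  have prod2: "(\<Prod>i=1..2. g i) = g 1 * g 2" for g :: "nat \<Rightarrow> real"
    by (simp add: numeral_2_eq_2)
  note add = base.prems(2)[unfolded multiadditive_def, rule_format]
  have "(\<Sum>j=1..k. \<bar>\<phi> (p (x 1 j) (x 2 j))\<bar>) \<le> C * (rad_norm (E 1) k (x 1) * rad_norm (E 2) k (x 2))"
  proof (rule sum_abs_biadditive_le)
    fix u v w assume *: "u \<in> carrier (E 1)" "v \<in> carrier (E 1)" "w \<in> carrier (E 2)"
    show "\<phi> (p (u \<oplus>\<^bsub>E 1\<^esub> v) w) = \<phi> (p u w) + \<phi> (p v w)"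
      using add[OF p, of u w 1 u v] * unfolding p1 by simp
  next
    fix u v w assume *: "u \<in> carrier (E 1)" "v \<in> carrier (E 2)" "w \<in> carrier (E 2)"
    show "\<phi> (p u (v \<oplus>\<^bsub>E 2\<^esub> w)) = \<phi> (p u v) + \<phi> (p u w)"
      using add[OF p, of u v 2 v w] * unfolding p2 by simp
  next
    fix u v assume *: "u \<in> carrier (E 1)" "v \<in> carrier (E 2)"
    show "\<bar>\<phi> (p u v)\<bar> \<le> C * (vnorm (E 1) u * vnorm (E 2) v)"
      using base.prems(3)[OF p[OF *]] unfolding prod2 p12 .
  qed (use base in auto)
  moreover have "(\<lambda>i\<in>{1..2}. x i j) = p (x 1 j) (x 2 j)" for j
    unfolding p_def set2 by auto
  ultimately show ?case unfolding prod2 by simp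
next
  case (Suc n)
  let ?N = "Suc n"
  interpret N: normed_vs "E ?N" using Suc.prems(1) by simp
  have xN: "x ?N j \<in> carrier (E ?N)" if "j \<in> {1..k}" for j
    using Suc.prems(5) that by simp
  define X where "X s = sign_sum (E ?N) k (x ?N) s" for s
  have X: "X s \<in> carrier (E ?N)" for s
    unfolding X_def by (rule N.sign_sum_closed[OF xN])
  define y where "y j = (\<lambda>i\<in>{1..n}. x i j)" for j
  have y: "y j \<in> (\<Pi>\<^sub>E i\<in>{1..n}. carrier (E i))" if "j \<in> {1..k}" for j
    using Suc.prems(5) that by (auto simp: y_def)
  have upd: "z(?N := u) \<in> (\<Pi>\<^sub>E i\<in>{1..?N}. carrier (E i))"
    if "z \<in> (\<Pi>\<^sub>E i\<in>{1..n}. carrier (E i))" "u \<in> carrier (E ?N)" for z u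
    using that by (auto simp: PiE_def Pi_def extensional_def)
  define \<rho> where "\<rho> = (\<Prod>i=1..n. rad_norm (E i) k (x i))"
  have \<rho>: "0 \<le> \<rho>"
    unfolding \<rho>_def by (intro prod_nonneg normed_vs.rad_norm_nonneg ballI) (use Suc.prems in auto)
  note add = Suc.prems(2)[unfolded multiadditive_def, rule_format]
  have IH: "(\<Sum>j=1..k. \<bar>\<phi> ((y j)(?N := u))\<bar>) \<le> C * vnorm (E ?N) u * \<rho>"
    if u: "u \<in> carrier (E ?N)" for u
    unfolding y_def \<rho>_def
  proof (rule Suc.IH[of "\<lambda>z. \<phi> (z(?N := u))"])
    show "multiadditive n E (\<lambda>z. \<phi> (z(?N := u)))"
      unfolding multiadditive_def
    proof (intro ballI)
      fix z i v w assume *: "z \<in> (\<Pi>\<^sub>E i\<in>{1..n}. carrier (E i))" "i \<in> {1..n}"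
        "v \<in> carrier (E i)" "w \<in> carrier (E i)"
      have "z(i := a, ?N := u) = z(?N := u, i := a)" for a
        using *(2) by (intro fun_upd_twist) auto
      then show "\<phi> (z(i := v \<oplus>\<^bsub>E i\<^esub> w, ?N := u)) = \<phi> (z(i := v, ?N := u)) + \<phi> (z(i := w, ?N := u))"
        using add[OF upd[OF *(1) u], of i v w] * by simp
    qed
    show "\<bar>\<phi> (z(?N := u))\<bar> \<le> C * vnorm (E ?N) u * (\<Prod>i=1..n. vnorm (E i) (z i))"
      if "z \<in> (\<Pi>\<^sub>E i\<in>{1..n}. carrier (E i))" for z
    proof -
      have "(\<Prod>i=1..n. vnorm (E i) ((z(?N := u)) i)) = (\<Prod>i=1..n. vnorm (E i) (z i))"
        by (intro prod.cong) auto
      then have "(\<Prod>i=1..?N. vnorm (E i) ((z(?N := u)) i)) = vnorm (E ?N) u * (\<Prod>i=1..n. vnorm (E i) (z i))"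
        by simp
      then show ?thesis
        using Suc.prems(3)[OF upd[OF that u]] by (simp only: mult.assoc)
    qed
  qed (use Suc.prems u in \<open>auto intro!: mult_nonneg_nonneg N.vnorm_nonneg\<close>)
  have "2 ^ k * (\<Sum>j=1..k. \<bar>\<phi> (\<lambda>i\<in>{1..?N}. x i j)\<bar>) 
      \<le> (\<Sum>j=1..k. \<Sum>s\<in>signs k. \<bar>\<phi> ((y j)(?N := X s))\<bar>)"
    unfolding sum_distrib_left
  proof (intro sum_mono)
    fix j assume j: "j \<in> {1..k}"
    have eq: "(\<lambda>i\<in>{1..?N}. x i j) = (y j)(?N := x ?N j)"
      by (auto simp: y_def fun_eq_iff)
    \<comment> \<open>Expand the form at \<open>X s\<close> in its last variable: multiplying by
      \<open>s j\<close> and summing over all sign vectors picks out the term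
      \<open>l = j\<close>.\<close>
    have "2 ^ k * \<phi> (\<lambda>i\<in>{1..?N}. x i j)
        = (\<Sum>l=1..k. (\<Sum>s\<in>signs k. s j * s l) * \<phi> ((y j)(?N := x ?N l)))"
      unfolding eq using j by (simp add: signs_orthogonal if_distrib[of "\<lambda>x. x * _"] cong: if_cong)
    also have "\<dots> = (\<Sum>s\<in>signs k. \<Sum>l=1..k. s j * s l * \<phi> ((y j)(?N := x ?N l)))"
      unfolding sum_distrib_right by (rule sum.swap)
    also have "\<dots> = (\<Sum>s\<in>signs k. s j * \<phi> ((y j)(?N := X s)))"
    proof (intro sum.cong refl)
      fix s assume s: "s \<in> signs k"
      have "\<phi> ((y j)(?N := X s)) = (\<Sum>l=1..k. s l * \<phi> ((y j)(?N := x ?N l)))"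
        unfolding X_def
      proof (rule N.additive_sign_sum[OF xN s])
        fix u v assume uv: "u \<in> carrier (E ?N)" "v \<in> carrier (E ?N)"
        show "\<phi> ((y j)(?N := u \<oplus>\<^bsub>E ?N\<^esub> v)) = \<phi> ((y j)(?N := u)) + \<phi> ((y j)(?N := v))"
          using add[OF upd[OF y[OF j] uv(1)], of ?N u v] uv by simp
      qed
      then show "(\<Sum>l=1..k. s j * s l * \<phi> ((y j)(?N := x ?N l))) = s j * \<phi> ((y j)(?N := X s))"
        by (simp add: sum_distrib_left mult_ac)
    qed
    finally have "2 ^ k * \<bar>\<phi> (\<lambda>i\<in>{1..?N}. x i j)\<bar> = \<bar>\<Sum>s\<in>signs k. s j * \<phi> ((y j)(?N := X s))\<bar>"
      by (metis abs_mult abs_of_nonneg zero_le_numeral zero_le_power)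
    also have "\<dots> \<le> (\<Sum>s\<in>signs k. \<bar>\<phi> ((y j)(?N := X s))\<bar>)"
      by (rule order.trans[OF sum_abs]) (intro sum_mono, use signs_cases[OF _ j] in fastforce)
    finally show "2 ^ k * \<bar>\<phi> (\<lambda>i\<in>{1..?N}. x i j)\<bar> \<le> (\<Sum>s\<in>signs k. \<bar>\<phi> ((y j)(?N := X s))\<bar>)" .
  qed
  also have "\<dots> = (\<Sum>s\<in>signs k. \<Sum>j=1..k. \<bar>\<phi> ((y j)(?N := X s))\<bar>)"
    by (rule sum.swap)
  also have "\<dots> \<le> (\<Sum>s\<in>signs k. C * vnorm (E ?N) (X s) * \<rho>)"
    by (intro sum_mono IH X)
  also have "\<dots> = C * \<rho> * (\<Sum>s\<in>signs k. vnorm (E ?N) (X s))"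
    by (simp add: sum_distrib_left mult_ac)
  also have "\<dots> \<le> C * \<rho> * (2 ^ k * rad_norm (E ?N) k (x ?N))"
  proof (rule mult_left_mono)
    \<comment> \<open>Cauchy-Schwarz against the constant 1 passes from the mean norm to the
      quadratic mean.\<close>
    have "(\<Sum>s\<in>signs k. vnorm (E ?N) (X s) * 1)\<^sup>2 \<le> (\<Sum>s\<in>signs k. (vnorm (E ?N) (X s))\<^sup>2) * (\<Sum>s\<in>signs k. 1\<^sup>2)"
      by (rule Cauchy_Schwarz_ineq_sum)
    also have "\<dots> = (2 ^ k * rad_norm (E ?N) k (x ?N))\<^sup>2"
    proof -
      have "rad_norm (E ?N) k (x ?N) = sqrt ((\<Sum>s\<in>signs k. (vnorm (E ?N) (X s))\<^sup>2) / 2 ^ k)"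
        unfolding X_def by (rule N.rad_norm_eq) (use xN in auto)
      then have "(rad_norm (E ?N) k (x ?N))\<^sup>2 = (\<Sum>s\<in>signs k. (vnorm (E ?N) (X s))\<^sup>2) / 2 ^ k"
        by (simp add: sum_nonneg)
      then show ?thesis
        by (simp add: card_signs power_mult_distrib) (simp add: power2_eq_square)
    qed
    finally have "(\<Sum>s\<in>signs k. vnorm (E ?N) (X s))\<^sup>2 \<le> (2 ^ k * rad_norm (E ?N) k (x ?N))\<^sup>2"
      unfolding mult_1_right .
    then show "(\<Sum>s\<in>signs k. vnorm (E ?N) (X s)) \<le> 2 ^ k * rad_norm (E ?N) k (x ?N)"
      by (rule power2_le_imp_le) (use N.rad_norm_nonneg[of k, OF xN] in simp)
  qed (use Suc.prems(4) \<rho> in simp)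
  finally have "2 ^ k * (\<Sum>j=1..k. \<bar>\<phi> (\<lambda>i\<in>{1..?N}. x i j)\<bar>) \<le> 2 ^ k * (C * \<rho> * rad_norm (E ?N) k (x ?N))"
    by (simp add: mult_ac)
  then have "(\<Sum>j=1..k. \<bar>\<phi> (\<lambda>i\<in>{1..?N}. x i j)\<bar>) \<le> C * \<rho> * rad_norm (E ?N) k (x ?N)"
    by (rule mult_left_le_imp_le) simp
  moreover have "(\<Prod>i=1..?N. rad_norm (E i) k (x i)) = \<rho> * rad_norm (E ?N) k (x ?N)"
    by (simp add: \<rho>_def)
  ultimately show ?case by (simp only: mult.assoc)
qed

section \<open>Bounded coordinates on finite-dimensional subspaces\<close>

text \<open>Vectors serve as their own indices. Coefficient functions are total on the type, so that
  they form a topological space with the product topology, in which the compactness argument takes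
  place; their values outside \<open>B\<close> do not affect the vector.\<close>

definition lin_comb :: "('k::rc_field, 'a) nvs \<Rightarrow> 'a set \<Rightarrow> ('a \<Rightarrow> 'k) \<Rightarrow> 'a" where
  "lin_comb X B a = (\<Oplus>\<^bsub>X\<^esub>b\<in>B. a b \<odot>\<^bsub>X\<^esub> b)"

context normed_vs
begin

section \<open>Module laws in terms of the field operations\<close>

lemma smult_closed' [simp]: "x \<in> carrier X \<Longrightarrow> (c::'k) \<odot> x \<in> carrier X"
  by (rule smult_closed) simp_all

lemma smult_one' [simp]: "x \<in> carrier X \<Longrightarrow> (1::'k) \<odot> x = x"
  using smult_one[of x] by (simp add: scalars_def)

lemma smult_zero [simp]: "x \<in> carrier X \<Longrightarrow> (0::'k) \<odot> x = \<zero>"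
  using smult_l_null[of x] by (simp add: scalars_def)

lemma smult_add: "x \<in> carrier X \<Longrightarrow> ((a::'k) + b) \<odot> x = a \<odot> x \<oplus> b \<odot> x"
  using smult_l_distr[of a b x] by (simp add: scalars_def)

lemma smult_mult: "x \<in> carrier X \<Longrightarrow> ((a::'k) * b) \<odot> x = a \<odot> (b \<odot> x)"
  using smult_assoc1[of a b x] by (simp add: scalars_def)

lemma minus_eq_smult: "x \<in> carrier X \<Longrightarrow> \<ominus> x = (- 1 :: 'k) \<odot> x"
  using smult_add[of x "-1" 1] by (intro M.minus_equality) simp_all

lemma a_minus_zero [simp]: "x \<in> carrier X \<Longrightarrow> x \<ominus> \<zero> = x"
  using M.minus_equality[of \<zero> \<zero>] by (simp add: a_minus_def)

lemma vnorm_zero [simp]: "vnorm X \<zero> = 0"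
  by (simp add: vnorm_eq_zero)

lemma vnorm_finsum_le:
  "finite A \<Longrightarrow> g \<in> A \<rightarrow> carrier X \<Longrightarrow> vnorm X (\<Oplus>j\<in>A. g j) \<le> (\<Sum>j\<in>A. vnorm X (g j))"
proof (induction A rule: finite_induct)
  case (insert a A)
  then have "vnorm X (g a \<oplus> (\<Oplus>j\<in>A. g j)) \<le> vnorm X (g a) + vnorm X (\<Oplus>j\<in>A. g j)"
    by (intro vnorm_triangle M.finsum_closed) auto
  with insert show ?case by (simp add: Pi_def M.finsum_insert)
qed simp

section \<open>Linear combinations and coordinates\<close>

lemma lin_comb_closed [simp]: "B \<subseteq> carrier X \<Longrightarrow> lin_comb X B a \<in> carrier X"
  unfolding lin_comb_def by (intro M.finsum_closed) auto

lemma lin_comb_cong: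
  "B \<subseteq> carrier X \<Longrightarrow> (\<And>b. b \<in> B \<Longrightarrow> a b = a' b) \<Longrightarrow> lin_comb X B a = lin_comb X B a'"
  unfolding lin_comb_def by (intro M.finsum_cong') auto

lemma lin_comb_add:
  "finite B \<Longrightarrow> B \<subseteq> carrier X \<Longrightarrow> lin_comb X B (\<lambda>b. a b + a' b) = lin_comb X B a \<oplus> lin_comb X B a'"
proof -
  assume B: "finite B" "B \<subseteq> carrier X"
  then have "lin_comb X B (\<lambda>b. a b + a' b) = (\<Oplus>b\<in>B. a b \<odot> b \<oplus> a' b \<odot> b)"
    unfolding lin_comb_def by (intro M.finsum_cong') (auto simp: smult_add)
  also have "\<dots> = lin_comb X B a \<oplus> lin_comb X B a'"
    unfolding lin_comb_def using B by (intro M.finsum_addf) auto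
  finally show ?thesis .
qed

lemma lin_comb_smult:
  "finite B \<Longrightarrow> B \<subseteq> carrier X \<Longrightarrow> lin_comb X B (\<lambda>b. c * a b) = c \<odot> lin_comb X B a"
  unfolding lin_comb_def
  by (subst finsum_smult_ldistr) (auto intro!: M.finsum_cong' simp: smult_mult subset_eq)

lemma lin_comb_zero: "B \<subseteq> carrier X \<Longrightarrow> lin_comb X B (\<lambda>_. 0) = \<zero>"
  unfolding lin_comb_def by (rule M.add.finprod_one_eqI) auto

lemma lin_comb_remove:
  assumes "finite B" "B \<subseteq> carrier X" "b \<in> B" "a b = 0"
  shows "lin_comb X B a = lin_comb X (B - {b}) a"
proof -
  have "lin_comb X (insert b (B - {b})) a = a b \<odot> b \<oplus> lin_comb X (B - {b}) a"
    unfolding lin_comb_def using assms by (intro M.finsum_insert) auto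
  also have "\<dots> = lin_comb X (B - {b}) a"
  proof -
    have "lin_comb X (B - {b}) a \<in> carrier X" using assms by (intro lin_comb_closed) auto
    then show ?thesis using assms by auto
  qed
  finally show ?thesis using assms by (simp add: insert_absorb)
qed

text \<open>The span is the least submodule containing \<open>B\<close>, and the linear combinations
  form such a submodule.\<close>

lemma lin_span_subset_lin_comb:
  assumes "finite B" "B \<subseteq> carrier X"
  shows "lin_span X B \<subseteq> range (lin_comb X B)"
  unfolding lin_span_def
proof (rule hull_minimal)
  show "B \<subseteq> range (lin_comb X B)"
  proof
    fix b assume b: "b \<in> B"
    have "lin_comb X B (\<lambda>b'. if b' = b then 1 else 0) = (\<Oplus>b'\<in>B. if b' = b then b' else \<zero>)"
      unfolding lin_comb_def using assms by (intro M.finsum_cong') auto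
    also have "\<dots> = b"
      using M.finsum_singleton[of b B "\<lambda>x. x"] b assms by (simp add: Pi_def subset_eq eq_commute[of b])
    finally show "b \<in> range (lin_comb X B)" by (metis rangeI)
  qed
  show "submodule (range (lin_comb X B)) scalars X"
  proof (rule submoduleI)
    show "\<zero> \<in> range (lin_comb X B)" using lin_comb_zero[OF assms(2)] by (metis rangeI)
    show "\<ominus> u \<in> range (lin_comb X B)" if "u \<in> range (lin_comb X B)" for u
      using that assms by (auto simp: minus_eq_smult lin_comb_smult[symmetric])
  qed (use assms in \<open>auto simp: lin_comb_smult[symmetric] lin_comb_add[symmetric]\<close>)
qed

text \<open>A spanning set of minimal cardinality is independent.\<close>

lemma finite_spanning_independent:
  assumes "finite B" "B \<subseteq> carrier X" "V \<subseteq> range (lin_comb X B)"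
  obtains B' where "finite B'" "B' \<subseteq> carrier X" "V \<subseteq> range (lin_comb X B')"
    "\<forall>a::'a \<Rightarrow> 'k. lin_comb X B' a = \<zero> \<longrightarrow> (\<forall>b\<in>B'. a b = 0)"
proof -
  define P where "P D \<longleftrightarrow> finite D \<and> D \<subseteq> carrier X \<and> V \<subseteq> range (lin_comb X D)" for D
  obtain B' where B': "P B'" and min: "\<And>D. P D \<Longrightarrow> card B' \<le> card D"
    using ex_has_least_nat[of P B card] assms by (auto simp: P_def)
  have fin: "finite B'" and sub: "B' \<subseteq> carrier X" using B' by (auto simp: P_def)
  have "a b = 0" if a: "lin_comb X B' a = \<zero>" and b: "b \<in> B'" for a b
  proof (rule ccontr)
    assume nz: "a b \<noteq> 0"
    have "P (B' - {b})"
      unfolding P_def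
    proof (intro conjI subsetI)
      fix v assume "v \<in> V"
      then obtain c where v: "v = lin_comb X B' c" using B' by (auto simp: P_def)
      \<comment> \<open>The multiple of the relation \<open>a\<close> is chosen so that the
        coefficient at \<open>b\<close> cancels; \<open>v\<close> is then a combination of the other
        vectors, against minimality.\<close>
      define c' where "c' = (\<lambda>i. c i + (- (c b / a b)) * a i)"
      have "lin_comb X B' c' = v \<oplus> (- (c b / a b)) \<odot> lin_comb X B' a"
        unfolding c'_def v using fin sub by (simp only: lin_comb_add lin_comb_smult)
      also have "\<dots> = v" using a fin sub v by simp
      finally have "v = lin_comb X (B' - {b}) c'"
        using lin_comb_remove[OF fin sub b, of c'] nz by (simp add: c'_def)
      then show "v \<in> range (lin_comb X (B' - {b}))" by blast
    qed (use fin sub in auto)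
    from min[OF this] card_Diff1_less[OF fin b] show False by linarith
  qed
  then show ?thesis using that B' by (auto simp: P_def)
qed

text \<open>By the triangle inequality the norm changes by at most a weighted sum of the coefficient
  differences. Only the finitely many coefficients in \<open>B\<close> occur, so coordinatewise
  convergence is enough.\<close>

lemma continuous_vnorm_lin_comb:
  assumes "finite B" "B \<subseteq> carrier X"
  shows "continuous_on UNIV (\<lambda>a. vnorm X (lin_comb X B a))"
proof -
  have diff: "\<bar>vnorm X (lin_comb X B a) - vnorm X (lin_comb X B a')\<bar> \<le> (\<Sum>b\<in>B. norm (a b - a' b) * vnorm X b)"
    for a a'
  proof -
    have *: "vnorm X (lin_comb X B a) \<le> vnorm X (lin_comb X B a') + (\<Sum>b\<in>B. norm (a b - a' b) * vnorm X b)"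
      for a a'
    proof -
      have "lin_comb X B a = lin_comb X B a' \<oplus> lin_comb X B (\<lambda>b. a b - a' b)"
        using assms by (simp flip: lin_comb_add)
      also have "vnorm X \<dots> \<le> vnorm X (lin_comb X B a') + vnorm X (lin_comb X B (\<lambda>b. a b - a' b))"
        using assms by (intro vnorm_triangle lin_comb_closed)
      also have "vnorm X (lin_comb X B (\<lambda>b. a b - a' b)) \<le> (\<Sum>b\<in>B. vnorm X ((a b - a' b) \<odot> b))"
        unfolding lin_comb_def using assms by (intro vnorm_finsum_le) auto
      also have "\<dots> = (\<Sum>b\<in>B. norm (a b - a' b) * vnorm X b)"
        using assms by (intro sum.cong vnorm_smult) auto
      finally show ?thesis by simp
    qed
    show ?thesis using *[of a a'] *[of a' a] by (simp add: norm_minus_commute abs_if)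
  qed
  show ?thesis
    unfolding continuous_on_def
  proof
    fix a :: "'a \<Rightarrow> 'k"
    have lim: "((\<lambda>a'. a' b) \<longlongrightarrow> a b) (at a)" for b
      using continuous_on_product_coordinates[of b] unfolding continuous_on_def by blast
    have "((\<lambda>a'. \<Sum>b\<in>B. norm (a' b - a b) * vnorm X b) \<longlongrightarrow> (\<Sum>b\<in>B. norm (a b - a b) * vnorm X b)) (at a)"
      by (intro tendsto_intros lim)
    then have "((\<lambda>a'. \<Sum>b\<in>B. norm (a' b - a b) * vnorm X b) \<longlongrightarrow> 0) (at a)" by simp
    then have "((\<lambda>a'. vnorm X (lin_comb X B a') - vnorm X (lin_comb X B a)) \<longlongrightarrow> 0) (at a)"
      by (rule Lim_null_comparison[rotated]) (use diff in simp)
    then show "((\<lambda>a'. vnorm X (lin_comb X B a')) \<longlongrightarrow> vnorm X (lin_comb X B a)) (at a)"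
      by (rule LIM_zero_cancel)
  qed
qed

text \<open>The equivalence of norms in finite dimension: the norm attains its minimum on the unit
  sphere of the maximum norm, independence makes this minimum positive, and scaling extends the
  bound to all coefficients.\<close>

lemma coefficient_bound:
  assumes fin: "finite B" and sub: "B \<subseteq> carrier X"
    and indep: "\<forall>a::'a \<Rightarrow> 'k. lin_comb X B a = \<zero> \<longrightarrow> (\<forall>b\<in>B. a b = 0)"
  obtains c where "0 < c" "\<forall>a::'a \<Rightarrow> 'k. \<forall>b\<in>B. c * norm (a b) \<le> vnorm X (lin_comb X B a)"
proof (cases "B = {}")
  case True
  then show ?thesis using that[of 1] by simp
next
  case False
  \<comment> \<open>For fixed \<open>b\<close> the product of these sets is the face of the unit
    sphere on which the coefficient at \<open>b\<close> has modulus 1. Coefficients outside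
    \<open>B\<close> are fixed to 0, which makes every factor compact; Tychonoff's theorem then
    applies to each face, and \<open>K\<close> is the union of finitely many faces.\<close>
  define S :: "'a \<Rightarrow> 'a \<Rightarrow> 'k set"
    where "S b i = (if i = b then sphere 0 1 else if i \<in> B then cball 0 1 else {0})" for b i
  define K where "K = (\<Union>b\<in>B. \<Pi>\<^sub>E i\<in>UNIV. S b i)"
  have comp: "compact K"
    unfolding K_def
  proof (rule compact_UN[OF fin])
    fix b
    have "compactin (product_topology (\<lambda>i. euclidean) UNIV) (\<Pi>\<^sub>E i\<in>UNIV. S b i)"
      by (rule compactin_PiE[THEN iffD2]) (auto simp: S_def)
    then show "compact (\<Pi>\<^sub>E i\<in>UNIV. S b i)"
      by (simp add: euclidean_product_topology)
  qed
  obtain b0 where b0: "b0 \<in> B" using False by blast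
  have "(\<lambda>i. if i = b0 then 1 else 0) \<in> K"
    unfolding K_def using b0 by (auto simp: S_def)
  then have "K \<noteq> {}" by blast
  then obtain a0 where a0: "a0 \<in> K" and min: "\<forall>a\<in>K. vnorm X (lin_comb X B a0) \<le> vnorm X (lin_comb X B a)"
    using continuous_attains_inf[OF comp _
        continuous_on_subset[OF continuous_vnorm_lin_comb[OF fin sub] subset_UNIV]] by auto
  define c where "c = vnorm X (lin_comb X B a0)"
  have "c \<noteq> 0"
  proof
    assume "c = 0"
    then have "lin_comb X B a0 = \<zero>" using sub by (simp add: c_def vnorm_eq_zero)
    then have zero: "\<forall>b\<in>B. a0 b = 0" by (rule indep[rule_format, THEN ballI])
    from a0 obtain b where "b \<in> B" "a0 b \<in> S b b" by (auto simp: K_def)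
    then show False using zero by (simp add: S_def)
  qed
  then have c: "0 < c" using sub vnorm_nonneg[of "lin_comb X B a0"] by (simp add: c_def)
  have "\<forall>a::'a \<Rightarrow> 'k. \<forall>b\<in>B. c * norm (a b) \<le> vnorm X (lin_comb X B a)"
  proof (intro allI ballI)
    fix a :: "'a \<Rightarrow> 'k" and b assume b: "b \<in> B"
    define m where "m = Max ((\<lambda>i. norm (a i)) ` B)"
    have m: "norm (a i) \<le> m" if "i \<in> B" for i
      using fin that by (simp add: m_def)
    have "m \<in> (\<lambda>i. norm (a i)) ` B" unfolding m_def using fin b by (intro Max_in) auto
    then obtain d where d: "d \<in> B" "norm (a d) = m" by auto
    show "c * norm (a b) \<le> vnorm X (lin_comb X B a)"
    proof (cases "m = 0")
      case True
      then show ?thesis using m[OF b] vnorm_nonneg[of "lin_comb X B a"] sub by simp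
    next
      case False
      moreover have "0 \<le> m" using d(2) by auto
      ultimately have m0: "0 < m" by simp
      \<comment> \<open>Division by the largest modulus \<open>m\<close>, attained at
        \<open>d\<close>, moves the coefficients to the face that belongs to
        \<open>d\<close>.\<close>
      define a' where "a' i = (if i \<in> B then of_real (1 / m) * a i else 0)" for i
      have "a' \<in> (\<Pi>\<^sub>E i\<in>UNIV. S d i)"
      proof (rule PiE_I)
        fix i
        have "norm (a' i) = (if i \<in> B then norm (a i) / m else 0)"
          using m0 by (simp add: a'_def norm_mult norm_divide)
        then show "a' i \<in> S d i"
          using m[of i] d m0 by (auto simp: S_def a'_def)
      qed simp
      then have "c \<le> vnorm X (lin_comb X B a')"
      proof -
        assume "a' \<in> (\<Pi>\<^sub>E i\<in>UNIV. S d i)"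
        then have "a' \<in> K" unfolding K_def using d(1) by blast
        then show ?thesis unfolding c_def by (rule min[rule_format])
      qed
      also have "lin_comb X B a' = of_real (1 / m) \<odot> lin_comb X B a"
      proof -
        have "lin_comb X B a' = lin_comb X B (\<lambda>i. of_real (1 / m) * a i)"
          by (rule lin_comb_cong[OF sub]) (simp add: a'_def)
        then show ?thesis by (simp only: lin_comb_smult[OF fin sub])
      qed
      also have "vnorm X \<dots> = vnorm X (lin_comb X B a) / m"
        using m0 sub by (simp add: vnorm_smult norm_divide)
      finally have "c * m \<le> vnorm X (lin_comb X B a)" unfolding pos_le_divide_eq[OF m0] .
      moreover have "c * norm (a b) \<le> c * m" using m[OF b] c by simp
      ultimately show ?thesis by linarith
    qed
  qed
  with c show ?thesis by (rule that)
qed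

text \<open>The functionals are the real components of the coordinates with respect to an
  independent spanning set: one index for each basis vector \<open>b\<close> and each element
  \<open>e\<close> of the real basis of the scalar field.\<close>

lemma finite_dim_functionals:
  assumes "finite B" "B \<subseteq> carrier X"
  obtains I :: "('a \<times> 'k) set" and C :: real and f :: "'a \<times> 'k \<Rightarrow> 'a \<Rightarrow> real"
  where "finite I" "0 \<le> C"
    "\<forall>i\<in>I. \<forall>u\<in>lin_span X B. \<forall>v\<in>lin_span X B. f i (u \<oplus> v) = f i u + f i v"
    "\<forall>i\<in>I. \<forall>v\<in>lin_span X B. \<bar>f i v\<bar> \<le> C * vnorm X v"
    "\<forall>v\<in>lin_span X B. vnorm X v \<le> (\<Sum>i\<in>I. \<bar>f i v\<bar>)"
proof -
  obtain D where fin: "finite D" and sub: "D \<subseteq> carrier X" and span: "lin_span X B \<subseteq> range (lin_comb X D)"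
    and indep: "\<forall>a::'a \<Rightarrow> 'k. lin_comb X D a = \<zero> \<longrightarrow> (\<forall>b\<in>D. a b = 0)"
    by (rule finite_spanning_independent[OF assms lin_span_subset_lin_comb[OF assms]])
  obtain c where c: "0 < c" and bd: "\<forall>a::'a \<Rightarrow> 'k. \<forall>b\<in>D. c * norm (a b) \<le> vnorm X (lin_comb X D a)"
    by (rule coefficient_bound[OF fin sub indep])
  define r where "r v = (SOME a. v = lin_comb X D a)" for v
  have r: "v = lin_comb X D (r v)" if "v \<in> lin_span X B" for v
  proof -
    have "\<exists>a. v = lin_comb X D a" using that span by blast
    then show ?thesis unfolding r_def by (rule someI_ex)
  qed
  \<comment> \<open>Uniqueness is what makes the arbitrarily chosen coefficients \<open>r\<close>
    additive.\<close>
  have unique: "a b = a' b" if "lin_comb X D a = lin_comb X D a'" "b \<in> D" for a a' b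
  proof -
    have "lin_comb X D (\<lambda>b. a b + (-1) * a' b) = lin_comb X D a' \<oplus> \<ominus> lin_comb X D a'"
      using that(1) fin sub by (simp only: lin_comb_add lin_comb_smult) (simp add: minus_eq_smult)
    also have "\<dots> = \<zero>" using sub by (simp add: M.r_neg)
    finally have "a b + (-1) * a' b = 0" using indep[THEN spec[of _ "\<lambda>b. a b + (-1) * a' b"]] that(2) by blast
    then show ?thesis by simp
  qed
  have r_add: "r (u \<oplus> v) b = r u b + r v b"
    if "u \<in> lin_span X B" "v \<in> lin_span X B" "u \<oplus> v \<in> lin_span X B" "b \<in> D" for u v b
  proof -
    have "lin_comb X D (r (u \<oplus> v)) = lin_comb X D (\<lambda>b. r u b + r v b)"
      using r[OF that(1)] r[OF that(2)] r[OF that(3)] lin_comb_add[OF fin sub, of "r u" "r v"] by argo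
    from unique[OF this that(4)] show ?thesis .
  qed
  have sum_closed: "u \<oplus> v \<in> lin_span X B" if "u \<in> lin_span X B" "v \<in> lin_span X B" for u v
    unfolding lin_span_def hull_def
  proof (rule InterI)
    fix H assume "H \<in> {t. submodule t scalars X \<and> B \<subseteq> t}"
    then have "submodule H scalars X" "u \<in> H" "v \<in> H"
      using that by (auto simp: lin_span_def hull_def)
    then show "u \<oplus> v \<in> H" by (rule submoduleE(5))
  qed
  \<comment> \<open>The weight \<open>vnorm X b\<close> is built in so that the triangle inequality
    yields domination of the norm with constant 1.\<close>
  define f where "f = (\<lambda>(b, e) v. vnorm X b * (r v b \<bullet> e))"
  \<comment> \<open>A coordinate at \<open>b\<close> is bounded with constant
    \<open>vnorm X b / c\<close>; the sum over \<open>D\<close> serves all indices at once.\<close>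
  define C where "C = (\<Sum>b\<in>D. vnorm X b / c)"
  have nn: "0 \<le> vnorm X b" if "b \<in> D" for b using that sub by (auto intro: vnorm_nonneg)
  show ?thesis
  proof (rule that[of "D \<times> Basis" C f])
    show "finite (D \<times> (Basis :: 'k set))" using fin by simp
    show "0 \<le> C" unfolding C_def using nn c by (intro sum_nonneg) simp
    show "\<forall>i\<in>D \<times> Basis. \<forall>u\<in>lin_span X B. \<forall>v\<in>lin_span X B. f i (u \<oplus> v) = f i u + f i v"
    proof (intro ballI)
      fix i u v assume i': "i \<in> D \<times> (Basis :: 'k set)" and uv: "u \<in> lin_span X B" "v \<in> lin_span X B"
      obtain b e where i: "i = (b, e)" "b \<in> D" using i' by auto
      have "r (u \<oplus> v) b = r u b + r v b"
        by (rule r_add[OF uv sum_closed[OF uv] i(2)])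
      then show "f i (u \<oplus> v) = f i u + f i v" by (simp add: f_def i(1) inner_add_left distrib_left)
    qed
    show "\<forall>i\<in>D \<times> Basis. \<forall>v\<in>lin_span X B. \<bar>f i v\<bar> \<le> C * vnorm X v"
    proof (intro ballI)
      fix i v assume i': "i \<in> D \<times> (Basis :: 'k set)" and v: "v \<in> lin_span X B"
      obtain b e where i: "i = (b, e)" "b \<in> D" "e \<in> Basis" using i' by auto
      have "\<bar>f i v\<bar> \<le> vnorm X b * norm (r v b)"
        using nn[OF i(2)] i(3) by (auto simp: f_def i(1) abs_mult intro!: mult_left_mono Basis_le_norm)
      also have "\<dots> \<le> vnorm X b * (vnorm X v / c)"
        using bd[rule_format, OF i(2), of "r v"] c nn[OF i(2)] unfolding r[OF v, symmetric]
        by (intro mult_left_mono) (simp_all add: field_simps)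
      also have "\<dots> = vnorm X b / c * vnorm X v" by simp
      also have "\<dots> \<le> C * vnorm X v"
        unfolding C_def 
        using i(2) fin nn c vnorm_nonneg[OF lin_comb_closed[OF sub, of "r v"], folded r[OF v]]
        by (intro mult_right_mono member_le_sum) auto
      finally show "\<bar>f i v\<bar> \<le> C * vnorm X v" .
    qed
    show "\<forall>v\<in>lin_span X B. vnorm X v \<le> (\<Sum>i\<in>D \<times> Basis. \<bar>f i v\<bar>)"
    proof
      fix v assume v: "v \<in> lin_span X B"
      have "vnorm X v = vnorm X (lin_comb X D (r v))" by (rule arg_cong[OF r[OF v]])
      also have "\<dots> \<le> (\<Sum>b\<in>D. vnorm X (r v b \<odot> b))"
        unfolding lin_comb_def using fin sub by (intro vnorm_finsum_le) auto
      also have "\<dots> = (\<Sum>b\<in>D. norm (r v b) * vnorm X b)"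
        using sub by (intro sum.cong vnorm_smult) auto
      also have "\<dots> \<le> (\<Sum>b\<in>D. (\<Sum>e\<in>Basis. \<bar>r v b \<bullet> e\<bar>) * vnorm X b)"
        using nn by (intro sum_mono mult_right_mono norm_le_l1)
      also have "\<dots> = (\<Sum>b\<in>D. \<Sum>e\<in>Basis. \<bar>f (b, e) v\<bar>)"
        using nn by (intro sum.cong refl) (auto simp: f_def sum_distrib_left abs_mult mult_ac)
      also have "\<dots> = (\<Sum>i\<in>D \<times> Basis. \<bar>f i v\<bar>)"
        by (simp add: sum.cartesian_product)
      finally show "vnorm X v \<le> (\<Sum>i\<in>D \<times> Basis. \<bar>f i v\<bar>)" .
    qed
  qed
qed

end

section \<open>Finite rank operators\<close>

lemma multilinear_op_closed:
  assumes "multilinear_op n E F T" "x \<in> (\<Pi>\<^sub>E i\<in>{1..n}. carrier (E i))"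
  shows "T x \<in> carrier F"
  using assms(1)[unfolded multilinear_op_def, THEN conjunct1] assms(2) by (rule funcset_mem)

lemma
  assumes T: "multilinear_op n E F T" and x: "x \<in> (\<Pi>\<^sub>E i\<in>{1..n}. carrier (E i))"
    and i: "i \<in> {1..n}" and u: "u \<in> carrier (E i)"
  shows multilinear_op_add: "v \<in> carrier (E i) \<Longrightarrow>
      T (x(i := u \<oplus>\<^bsub>E i\<^esub> v)) = T (x(i := u)) \<oplus>\<^bsub>F\<^esub> T (x(i := v))"
    and multilinear_op_smult: "T (x(i := c \<odot>\<^bsub>E i\<^esub> u)) = c \<odot>\<^bsub>F\<^esub> T (x(i := u))"
proof -
  note * = T[unfolded multilinear_op_def, THEN conjunct2, THEN bspec, OF x, THEN bspec, OF i, THEN bspec, OF u]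
  show "T (x(i := u \<oplus>\<^bsub>E i\<^esub> v)) = T (x(i := u)) \<oplus>\<^bsub>F\<^esub> T (x(i := v))" if "v \<in> carrier (E i)"
    by (rule *[THEN conjunct1, THEN bspec, OF that])
  show "T (x(i := c \<odot>\<^bsub>E i\<^esub> u)) = c \<odot>\<^bsub>F\<^esub> T (x(i := u))"
    by (rule *[THEN conjunct2, THEN spec])
qed

text \<open>Multilinearity speaks of one variable at a time, so the induction is over the set
  \<open>A\<close> of variables that are already scaled.\<close>

lemma multilinear_op_scale:
  fixes E :: "nat \<Rightarrow> ('k::rc_field, 'a) nvs"
  assumes E: "\<And>i. i \<in> {1..n} \<Longrightarrow> normed_vs (E i)" and F: "normed_vs F"
    and T: "multilinear_op n E F T" and x: "x \<in> (\<Pi>\<^sub>E i\<in>{1..n}. carrier (E i))"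
  shows "T (\<lambda>i\<in>{1..n}. c i \<odot>\<^bsub>E i\<^esub> x i) = (\<Prod>i=1..n. c i) \<odot>\<^bsub>F\<^esub> T x"
proof -
  interpret F: normed_vs F by fact
  have xi: "x i \<in> carrier (E i)" if "i \<in> {1..n}" for i using x that by auto
  have Tx: "T x \<in> carrier F" using T x by (rule multilinear_op_closed)
  have "finite A \<Longrightarrow> A \<subseteq> {1..n} \<Longrightarrow>
    T (\<lambda>i\<in>{1..n}. if i \<in> A then c i \<odot>\<^bsub>E i\<^esub> x i else x i) = (\<Prod>i\<in>A. c i) \<odot>\<^bsub>F\<^esub> T x" for A
  proof (induction A rule: finite_induct)
    case empty
    have "(\<lambda>i\<in>{1..n}. x i) = x" using x by (rule PiE_restrict)
    then show ?case using Tx by simp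
  next
    case (insert a A)
    let ?y = "\<lambda>i\<in>{1..n}. if i \<in> A then c i \<odot>\<^bsub>E i\<^esub> x i else x i"
    have "c i \<odot>\<^bsub>E i\<^esub> x i \<in> carrier (E i)" if "i \<in> {1..n}" for i
      by (rule normed_vs.smult_closed'[OF E[OF that] xi[OF that]])
    then have y: "?y \<in> (\<Pi>\<^sub>E i\<in>{1..n}. carrier (E i))"
      using xi by simp
    have a: "a \<in> {1..n}" using insert.prems by simp
    have upd: "(\<lambda>i\<in>{1..n}. if i \<in> insert a A then c i \<odot>\<^bsub>E i\<^esub> x i else x i) = ?y(a := c a \<odot>\<^bsub>E a\<^esub> x a)"
      using a by (auto simp: fun_eq_iff)
    have same: "?y(a := x a) = ?y"
      using a insert.hyps by (auto simp: fun_eq_iff)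
    have IH: "T ?y = (\<Prod>i\<in>A. c i) \<odot>\<^bsub>F\<^esub> T x" by (rule insert.IH) (use insert.prems in simp)
    have "T (?y(a := c a \<odot>\<^bsub>E a\<^esub> x a)) = c a \<odot>\<^bsub>F\<^esub> T (?y(a := x a))"
      by (rule multilinear_op_smult[OF T y a xi[OF a]])
    also have "\<dots> = (\<Prod>i\<in>insert a A. c i) \<odot>\<^bsub>F\<^esub> T x"
      unfolding same IH using insert.hyps Tx by (simp add: F.smult_mult)
    finally show ?case unfolding upd .
  qed
  from this[of "{1..n}"]
  have "T (\<lambda>i\<in>{1..n}. if i \<in> {1..n} then c i \<odot>\<^bsub>E i\<^esub> x i else x i) = (\<Prod>i=1..n. c i) \<odot>\<^bsub>F\<^esub> T x"
    by simp
  moreover have "(\<lambda>i\<in>{1..n}. if i \<in> {1..n} then c i \<odot>\<^bsub>E i\<^esub> x i else x i) = (\<lambda>i\<in>{1..n}. c i \<odot>\<^bsub>E i\<^esub> x i)"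
    by (rule restrict_ext) simp
  ultimately show ?thesis by simp
qed

text \<open>Continuity at the origin gives a box of radius \<open>\<rho>\<close> on which the
  operator has norm below 1. Scaling every variable separately to norm \<open>\<rho> / 2\<close>
  puts a point into this box, and undoing the scaling gives the constant
  \<open>(2 / \<rho>) ^ n\<close>.\<close>

lemma continuous_multilinear_bounded:
  fixes E :: "nat \<Rightarrow> ('k::rc_field, 'a) nvs"
  assumes n: "1 \<le> n" and E: "\<And>i. i \<in> {1..n} \<Longrightarrow> normed_vs (E i)" and F: "normed_vs F"
    and T: "T \<in> continuous_multilinear_ops n E F"
  obtains C where "0 \<le> C"
    "\<forall>x \<in> (\<Pi>\<^sub>E i\<in>{1..n}. carrier (E i)). vnorm F (T x) \<le> C * (\<Prod>i=1..n. vnorm (E i) (x i))"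
proof -
  interpret F: normed_vs F by fact
  interpret FM: Metric_space "carrier F" "vdist F" by (rule F.Metric_space_vdist)
  let ?P = "\<Pi>\<^sub>E i\<in>{1..n}. carrier (E i)"
  have lin: "multilinear_op n E F T"
    and cont: "continuous_map (product_topology (\<lambda>i. vtopology (E i)) {1..n}) FM.mtopology T"
    using T by (auto simp: continuous_multilinear_ops_def vtopology_def)
  have MS: "Metric_space (carrier (E i)) (vdist (E i))" if "i \<in> {1..n}" for i
    by (rule normed_vs.Metric_space_vdist[OF E[OF that]])
  have top: "topspace (vtopology (E i)) = carrier (E i)" if "i \<in> {1..n}" for i
    using Metric_space.topspace_mtopology[OF MS[OF that]] by (simp add: vtopology_def)
  have TF: "T x \<in> carrier F" if "x \<in> ?P" for x
    using lin that by (rule multilinear_op_closed)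
  have zero_coord: "T x = \<zero>\<^bsub>F\<^esub>" if x: "x \<in> ?P" and i: "i \<in> {1..n}" and "x i = \<zero>\<^bsub>E i\<^esub>" for x i
  proof -
    have xi: "x i \<in> carrier (E i)" using x i by auto
    have "x = x(i := 0 \<odot>\<^bsub>E i\<^esub> x i)"
      using that normed_vs.smult_zero[OF E[OF i] xi] by (simp add: fun_upd_idem)
    then have "T x = T (x(i := 0 \<odot>\<^bsub>E i\<^esub> x i))" by simp
    also have "\<dots> = 0 \<odot>\<^bsub>F\<^esub> T (x(i := x i))"
      by (rule multilinear_op_smult[OF lin x i xi])
    also have "\<dots> = \<zero>\<^bsub>F\<^esub>" using TF[OF x] by simp
    finally show ?thesis .
  qed
  define z where "z = (\<lambda>i\<in>{1..n}. \<zero>\<^bsub>E i\<^esub>)"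
  have zero_cl: "\<zero>\<^bsub>E i\<^esub> \<in> carrier (E i)" if "i \<in> {1..n}" for i
  proof -
    interpret Ei: normed_vs "E i" by (rule E[OF that])
    show ?thesis by simp
  qed
  have z: "z \<in> ?P" using zero_cl by (auto simp: z_def)
  \<comment> \<open>The value at the origin vanishes because there is a variable, namely the one at
    index 1, that is zero.\<close>
  have Tz: "T z = \<zero>\<^bsub>F\<^esub>" by (rule zero_coord[OF z, of 1]) (use n in \<open>auto simp: z_def\<close>)
  have zt: "z \<in> topspace (product_topology (\<lambda>i. vtopology (E i)) {1..n})"
    using z top by (auto simp: PiE_iff)
  obtain U where U: "openin (product_topology (\<lambda>i. vtopology (E i)) {1..n}) U" "z \<in> U"
    and TU: "\<forall>y\<in>U. T y \<in> FM.mball (T z) 1"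
    using cont[unfolded FM.continuous_map_to_metric, rule_format, OF zt zero_less_one] by blast
  obtain V where V: "\<forall>i\<in>{1..n}. openin (vtopology (E i)) (V i)" and zV: "z \<in> Pi\<^sub>E {1..n} V"
    and VU: "Pi\<^sub>E {1..n} V \<subseteq> U"
    using U(1)[unfolded openin_product_topology_alt, rule_format, OF U(2)] by blast
  have "\<exists>r>0. \<forall>u\<in>carrier (E i). vnorm (E i) u < r \<longrightarrow> u \<in> V i" if i: "i \<in> {1..n}" for i
  proof -
    interpret Ei: normed_vs "E i" by (rule E[OF i])
    interpret M: Metric_space "carrier (E i)" "vdist (E i)" by (rule MS[OF i])
    have "\<zero>\<^bsub>E i\<^esub> \<in> V i" using zV i by (auto simp: z_def PiE_iff)
    moreover have "openin M.mtopology (V i)" using V i by (simp add: vtopology_def)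
    ultimately obtain r where r: "r > 0" "M.mball \<zero>\<^bsub>E i\<^esub> r \<subseteq> V i"
      unfolding M.openin_mtopology by blast
    have "u \<in> V i" if u: "u \<in> carrier (E i)" "vnorm (E i) u < r" for u
    proof -
      have "vdist (E i) \<zero>\<^bsub>E i\<^esub> u = vdist (E i) u \<zero>\<^bsub>E i\<^esub>" by (rule M.commute)
      also have "\<dots> = vnorm (E i) u" using u by (simp add: vdist_def)
      finally show ?thesis using u r(2) by auto
    qed
    with r(1) show ?thesis by blast
  qed
  then have "\<forall>i\<in>{1..n}. \<exists>r. r > 0 \<and> (\<forall>u\<in>carrier (E i). vnorm (E i) u < r \<longrightarrow> u \<in> V i)"
    by blast
  from bchoice[OF this]
  obtain r where r: "\<forall>i\<in>{1..n}. r i > 0 \<and> (\<forall>u\<in>carrier (E i). vnorm (E i) u < r i \<longrightarrow> u \<in> V i)"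
    by blast
  define \<rho> where "\<rho> = Min (r ` {1..n})"
  have ne: "{1..n} \<noteq> {}" using n by simp
  have \<rho>: "0 < \<rho>" unfolding \<rho>_def using r ne by (subst Min_gr_iff) auto
  have \<rho>r: "\<rho> \<le> r i" if "i \<in> {1..n}" for i unfolding \<rho>_def using that by (intro Min_le) auto
  have "\<forall>x\<in>?P. vnorm F (T x) \<le> (2 / \<rho>) ^ n * (\<Prod>i=1..n. vnorm (E i) (x i))"
  proof
    fix x assume x: "x \<in> ?P"
    have xi: "x i \<in> carrier (E i)" if "i \<in> {1..n}" for i using x that by auto
    have nn: "0 \<le> vnorm (E i) (x i)" if "i \<in> {1..n}" for i
      by (rule normed_vs.vnorm_nonneg[OF E[OF that] xi[OF that]])
    show "vnorm F (T x) \<le> (2 / \<rho>) ^ n * (\<Prod>i=1..n. vnorm (E i) (x i))"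
    \<comment> \<open>A zero vector cannot be scaled to positive norm; in that case both sides
      vanish.\<close>
    proof (cases "\<exists>i\<in>{1..n}. x i = \<zero>\<^bsub>E i\<^esub>")
      case True
      then have "T x = \<zero>\<^bsub>F\<^esub>" using zero_coord[OF x] by blast
      moreover have "0 \<le> (2 / \<rho>) ^ n * (\<Prod>i=1..n. vnorm (E i) (x i))"
        using \<rho> nn by (intro mult_nonneg_nonneg prod_nonneg) auto
      ultimately show ?thesis by simp
    next
      case False
      have pos: "0 < vnorm (E i) (x i)" if "i \<in> {1..n}" for i
        using nn[OF that] False normed_vs.vnorm_eq_zero[OF E[OF that] xi[OF that]] that
        by (simp add: less_le)
      \<comment> \<open>Half of \<open>\<rho>\<close> keeps the scaled vectors strictly inside the
        open box.\<close>
      define c where "c i = \<rho> / (2 * vnorm (E i) (x i))" for i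
      define y where "y = (\<lambda>i\<in>{1..n}. (of_real (c i) :: 'k) \<odot>\<^bsub>E i\<^esub> x i)"
      have "y i \<in> V i" if i: "i \<in> {1..n}" for i
      proof -
        interpret Ei: normed_vs "E i" by (rule E[OF i])
        have "vnorm (E i) (y i) = \<bar>c i\<bar> * vnorm (E i) (x i)"
          using i xi[OF i] by (simp add: y_def Ei.vnorm_smult)
        also have "\<dots> = \<rho> / 2" using pos[OF i] \<rho> by (simp add: c_def)
        also have "\<dots> < r i" using \<rho>r[OF i] \<rho> by simp
        finally show ?thesis using r i xi[OF i] by (auto simp: y_def)
      qed
      then have "y \<in> U" using VU by (auto simp: y_def)
      then have "T y \<in> FM.mball (T z) 1" using TU by blast
      then have Ty: "T y \<in> carrier F" and d: "vdist F (T y) (T z) < 1"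
        by (auto simp: FM.commute)
      have "vnorm F (T y) < 1" using d Ty by (simp add: Tz vdist_def)
      moreover have "T y = (\<Prod>i=1..n. of_real (c i)) \<odot>\<^bsub>F\<^esub> T x"
        unfolding y_def by (rule multilinear_op_scale[OF E F lin x])
      ultimately have lt: "(\<Prod>i=1..n. \<bar>c i\<bar>) * vnorm F (T x) < 1"
        using TF[OF x] by (simp add: F.vnorm_smult prod_norm[symmetric])
      have Q: "0 < (\<Prod>i=1..n. vnorm (E i) (x i))" using pos by (intro prod_pos) auto
      have "(\<Prod>i=1..n. \<bar>c i\<bar>) * (\<Prod>i=1..n. vnorm (E i) (x i)) = (\<Prod>i=1..n. \<rho> / 2)"
        unfolding prod.distrib[symmetric]
      proof (rule prod.cong)
        fix i assume "i \<in> {1..n}"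
        from pos[OF this] show "\<bar>c i\<bar> * vnorm (E i) (x i) = \<rho> / 2"
          using \<rho> by (simp add: c_def abs_mult)
      qed simp
      then have "(\<rho> / 2) ^ n * vnorm F (T x)
          = ((\<Prod>i=1..n. \<bar>c i\<bar>) * vnorm F (T x)) * (\<Prod>i=1..n. vnorm (E i) (x i))"
        by (simp add: mult_ac)
      also have "\<dots> \<le> 1 * (\<Prod>i=1..n. vnorm (E i) (x i))"
        using lt Q by (intro mult_right_mono) linarith+
      finally have "(\<rho> / 2) ^ n * vnorm F (T x) \<le> (\<Prod>i=1..n. vnorm (E i) (x i))" by simp
      then have "(2 / \<rho>) ^ n * ((\<rho> / 2) ^ n * vnorm F (T x)) \<le> (2 / \<rho>) ^ n * (\<Prod>i=1..n. vnorm (E i) (x i))"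
        using \<rho> by (intro mult_left_mono) auto
      moreover have "(2 / \<rho>) ^ n * (\<rho> / 2) ^ n = 1"
        using \<rho> by (simp flip: power_mult_distrib)
      ultimately show ?thesis by (simp flip: mult.assoc)
    qed
  qed
  moreover have "0 \<le> (2 / \<rho>) ^ n" using \<rho> by simp
  ultimately show ?thesis using that by blast
qed

text \<open>The forms are the real coordinates composed with the operator. Finite rank places all
  its values in the span of a finite set, where these coordinates are additive and bounded.\<close>

lemma finite_rank_dominated:
  fixes E :: "nat \<Rightarrow> ('k::rc_field, 'a) nvs" and F :: "('k, 'b) nvs"
  assumes n: "1 \<le> n" and E: "\<And>i. i \<in> {1..n} \<Longrightarrow> normed_vs (E i)" and F: "normed_vs F"
    and T: "T \<in> continuous_multilinear_ops n E F" and fr: "finite_rank n E F T"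
  obtains I :: "('b \<times> 'k) set" and \<phi> :: "'b \<times> 'k \<Rightarrow> (nat \<Rightarrow> 'a) \<Rightarrow> real" and C :: real
  where "finite I" "0 \<le> C" "\<forall>l\<in>I. multiadditive n E (\<phi> l)"
    "\<forall>l\<in>I. \<forall>x \<in> (\<Pi>\<^sub>E i\<in>{1..n}. carrier (E i)). \<bar>\<phi> l x\<bar> \<le> C * (\<Prod>i=1..n. vnorm (E i) (x i))"
    "\<forall>x \<in> (\<Pi>\<^sub>E i\<in>{1..n}. carrier (E i)). vnorm F (T x) \<le> (\<Sum>l\<in>I. \<bar>\<phi> l x\<bar>)"
proof -
  interpret F: normed_vs F by fact
  let ?P = "\<Pi>\<^sub>E i\<in>{1..n}. carrier (E i)"
  obtain B where B: "finite B" "B \<subseteq> carrier F" "lin_span F (T ` ?P) = lin_span F B"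
    using fr unfolding finite_rank_def by blast
  have span: "T x \<in> lin_span F B" if "x \<in> ?P" for x
    using hull_subset[of "T ` ?P" "\<lambda>H. submodule H scalars F"] that B(3) by (auto simp: lin_span_def)
  have lin: "multilinear_op n E F T" using T by (simp add: continuous_multilinear_ops_def)
  obtain I :: "('b \<times> 'k) set" and f :: "'b \<times> 'k \<Rightarrow> 'b \<Rightarrow> real" and C :: real where I: "finite I" and C: "0 \<le> C"
    and add: "\<forall>i\<in>I. \<forall>u\<in>lin_span F B. \<forall>v\<in>lin_span F B. f i (u \<oplus>\<^bsub>F\<^esub> v) = f i u + f i v"
    and bd: "\<forall>i\<in>I. \<forall>v\<in>lin_span F B. \<bar>f i v\<bar> \<le> C * vnorm F v"
    and dom: "\<forall>v\<in>lin_span F B. vnorm F v \<le> (\<Sum>i\<in>I. \<bar>f i v\<bar>)"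
    by (rule F.finite_dim_functionals[OF B(1,2)])
  obtain D where D: "0 \<le> D" "\<forall>x\<in>?P. vnorm F (T x) \<le> D * (\<Prod>i=1..n. vnorm (E i) (x i))"
    by (rule continuous_multilinear_bounded[OF n E F T])
  show ?thesis
  proof (rule that[of I "C * D" "\<lambda>l x. f l (T x)"])
    show "\<forall>l\<in>I. multiadditive n E (\<lambda>x. f l (T x))"
      unfolding multiadditive_def
    proof (intro ballI)
      fix l x i u v
      assume *: "l \<in> I" "x \<in> ?P" "i \<in> {1..n}" "u \<in> carrier (E i)" "v \<in> carrier (E i)"
      have P: "x(i := w) \<in> ?P" if "w \<in> carrier (E i)" for w
        using * that by (auto simp: PiE_iff extensional_def)
      have "T (x(i := u \<oplus>\<^bsub>E i\<^esub> v)) = T (x(i := u)) \<oplus>\<^bsub>F\<^esub> T (x(i := v))"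
        by (rule multilinear_op_add[OF lin *(2,3,4,5)])
      then show "f l (T (x(i := u \<oplus>\<^bsub>E i\<^esub> v))) = f l (T (x(i := u))) + f l (T (x(i := v)))"
        using add[rule_format, OF *(1) span[OF P[OF *(4)]] span[OF P[OF *(5)]]] by simp
    qed
    show "\<forall>l\<in>I. \<forall>x\<in>?P. \<bar>f l (T x)\<bar> \<le> C * D * (\<Prod>i=1..n. vnorm (E i) (x i))"
    proof (intro ballI)
      fix l x assume *: "l \<in> I" "x \<in> ?P"
      have "\<bar>f l (T x)\<bar> \<le> C * vnorm F (T x)" by (rule bd[rule_format, OF *(1) span[OF *(2)]])
      also have "\<dots> \<le> C * (D * (\<Prod>i=1..n. vnorm (E i) (x i)))"
        using D(2) *(2) C by (intro mult_left_mono) auto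
      finally show "\<bar>f l (T x)\<bar> \<le> C * D * (\<Prod>i=1..n. vnorm (E i) (x i))" by (simp only: mult.assoc)
    qed
    show "\<forall>x\<in>?P. vnorm F (T x) \<le> (\<Sum>l\<in>I. \<bar>f l (T x)\<bar>)" using dom span by blast
  qed (use I C D in auto)
qed

text \<open>Every entry is at most the \<open>p\<close>-norm, so a factor
  \<open>a j powr (q - p)\<close> can be estimated by the same power of the \<open>p\<close>-norm
  and taken out of the sum.\<close>

lemma sum_powr_root_antimono:
  fixes a :: "'i \<Rightarrow> real"
  assumes "finite A" "\<And>j. j \<in> A \<Longrightarrow> 0 \<le> a j" "0 < p" "p \<le> q"
  shows "(\<Sum>j\<in>A. a j powr q) powr (1 / q) \<le> (\<Sum>j\<in>A. a j powr p) powr (1 / p)"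
proof -
  define S where "S = (\<Sum>j\<in>A. a j powr p)"
  have S0: "0 \<le> S" unfolding S_def by (intro sum_nonneg) simp
  have le: "a j \<le> S powr (1 / p)" if "j \<in> A" for j
  proof -
    have "a j powr p \<le> S" unfolding S_def by (rule member_le_sum) (use assms that in auto)
    then have "(a j powr p) powr (1 / p) \<le> S powr (1 / p)" by (intro powr_mono2) (use assms in auto)
    then show ?thesis using assms that by (simp add: powr_powr)
  qed
  have "(\<Sum>j\<in>A. a j powr q) \<le> (\<Sum>j\<in>A. a j powr p * (S powr (1 / p)) powr (q - p))"
  proof (rule sum_mono)
    fix j assume j: "j \<in> A"
    have "a j powr q = a j powr p * a j powr (q - p)" by (simp flip: powr_add)
    also have "\<dots> \<le> a j powr p * (S powr (1 / p)) powr (q - p)"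
      by (rule mult_left_mono, rule powr_mono2) (use le[OF j] assms j in auto)
    finally show "a j powr q \<le> a j powr p * (S powr (1 / p)) powr (q - p)" .
  qed
  also have "\<dots> = S * (S powr (1 / p)) powr (q - p)"
    by (simp add: S_def sum_distrib_right)
  also have "\<dots> = S powr (q / p)"
  proof (cases "S = 0")
    case False
    then have "S * (S powr (1 / p)) powr (q - p) = S powr 1 * S powr ((q - p) / p)"
      using S0 by (simp add: powr_powr)
    also have "\<dots> = S powr (1 + (q - p) / p)" by (rule powr_add[symmetric])
    also have "1 + (q - p) / p = q / p" using assms by (simp add: field_simps)
    finally show ?thesis .
  qed simp
  finally have "(\<Sum>j\<in>A. a j powr q) powr (1 / q) \<le> (S powr (q / p)) powr (1 / q)"
    by (intro powr_mono2) (use assms in \<open>auto intro: sum_nonneg\<close>)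
  also have "\<dots> = S powr (1 / p)" using assms by (simp add: powr_powr)
  finally show ?thesis by (simp add: S_def)
qed

text \<open>Reduces the positive half of the characterization to the least proper exponent
  \<open>2 / n\<close>.\<close>

lemma has_cotype_mono:
  fixes E :: "nat \<Rightarrow> ('k::rc_field, 'a) nvs" and F :: "('k, 'b) nvs"
  assumes F: "normed_vs F" and T: "multilinear_op n E F T" and "has_cotype p n E F T" "p \<le> q"
  shows "has_cotype q n E F T"
proof -
  obtain M where p: "0 < p" and M: "M > 0" and
    le: "\<And>k x. k \<ge> 1 \<Longrightarrow> (\<forall>i\<in>{1..n}. \<forall>j\<in>{1..k}. x i j \<in> carrier (E i)) \<Longrightarrow>
        (\<Sum>j=1..k. vnorm F (T (\<lambda>i\<in>{1..n}. x i j)) powr p) powr (1 / p)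
          \<le> M * (\<Prod>i=1..n. rad_norm (E i) k (x i))"
    using assms(3) unfolding has_cotype_def by blast
  show ?thesis
    unfolding has_cotype_def
  proof (intro conjI exI[of _ M] allI impI)
    fix k :: nat and x assume k: "k \<ge> 1" and x: "\<forall>i\<in>{1..n}. \<forall>j\<in>{1..k}. x i j \<in> carrier (E i)"
    have "(\<Sum>j=1..k. vnorm F (T (\<lambda>i\<in>{1..n}. x i j)) powr q) powr (1 / q)
        \<le> (\<Sum>j=1..k. vnorm F (T (\<lambda>i\<in>{1..n}. x i j)) powr p) powr (1 / p)"
    proof (rule sum_powr_root_antimono)
      fix j assume "j \<in> {1..k}"
      then have "(\<lambda>i\<in>{1..n}. x i j) \<in> (\<Pi>\<^sub>E i\<in>{1..n}. carrier (E i))" using x by auto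
      then have "T (\<lambda>i\<in>{1..n}. x i j) \<in> carrier F" by (rule multilinear_op_closed[OF T])
      then show "0 \<le> vnorm F (T (\<lambda>i\<in>{1..n}. x i j))" by (rule normed_vs.vnorm_nonneg[OF F])
    qed (use p assms(4) in auto)
    also note le[OF k x]
    finally show "(\<Sum>j=1..k. vnorm F (T (\<lambda>i\<in>{1..n}. x i j)) powr q) powr (1 / q)
        \<le> M * (\<Prod>i=1..n. rad_norm (E i) k (x i))" .
  qed (use p M assms(4) in auto)
qed

lemma finite_rank_cotype_1:
  fixes E :: "nat \<Rightarrow> ('k::rc_field, 'a) nvs" and F :: "('k, 'b) nvs"
  assumes n: "2 \<le> n" and E: "\<And>i. i \<in> {1..n} \<Longrightarrow> normed_vs (E i)" and F: "normed_vs F"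
    and T: "T \<in> continuous_multilinear_ops n E F" and fr: "finite_rank n E F T"
  shows "has_cotype 1 n E F T"
proof -
  interpret F: normed_vs F by fact
  let ?P = "\<Pi>\<^sub>E i\<in>{1..n}. carrier (E i)"
  have lin: "multilinear_op n E F T" using T by (simp add: continuous_multilinear_ops_def)
  obtain I :: "('b \<times> 'k) set" and \<phi> :: "'b \<times> 'k \<Rightarrow> (nat \<Rightarrow> 'a) \<Rightarrow> real" and C :: real where I: "finite I" and C: "0 \<le> C"
    and add: "\<forall>l\<in>I. multiadditive n E (\<phi> l)"
    and bd: "\<forall>l\<in>I. \<forall>x \<in> ?P. \<bar>\<phi> l x\<bar> \<le> C * (\<Prod>i=1..n. vnorm (E i) (x i))"
    and dom: "\<forall>x \<in> ?P. vnorm F (T x) \<le> (\<Sum>l\<in>I. \<bar>\<phi> l x\<bar>)"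
    by (rule finite_rank_dominated[OF _ E F T fr]) (use n in auto)
  show ?thesis
    unfolding has_cotype_def
  \<comment> \<open>Each of the \<open>card I\<close> forms contributes \<open>C\<close>; the
    summand 1 keeps the constant positive when there are no forms or \<open>C = 0\<close>.\<close>
  proof (intro conjI exI[of _ "card I * C + 1"] allI impI)
    fix k :: nat and x assume k: "k \<ge> 1" and x: "\<forall>i\<in>{1..n}. \<forall>j\<in>{1..k}. x i j \<in> carrier (E i)"
    define y where "y j = (\<lambda>i\<in>{1..n}. x i j)" for j
    define R where "R = (\<Prod>i=1..n. rad_norm (E i) k (x i))"
    have R: "0 \<le> R"
      unfolding R_def by (intro prod_nonneg ballI normed_vs.rad_norm_nonneg[OF E]) (use x in auto)
    have y: "y j \<in> ?P" if "j \<in> {1..k}" for j using x that by (auto simp: y_def)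
    have nn: "0 \<le> vnorm F (T (y j))" if "j \<in> {1..k}" for j
    proof (rule F.vnorm_nonneg)
      show "T (y j) \<in> carrier F" by (rule multilinear_op_closed[OF lin y[OF that]])
    qed
    have "(\<Sum>j=1..k. vnorm F (T (y j))) \<le> (\<Sum>j=1..k. \<Sum>l\<in>I. \<bar>\<phi> l (y j)\<bar>)"
      by (rule sum_mono) (use dom y in blast)
    also have "\<dots> = (\<Sum>l\<in>I. \<Sum>j=1..k. \<bar>\<phi> l (y j)\<bar>)" by (rule sum.swap)
    also have "\<dots> \<le> (\<Sum>l\<in>I. C * R)"
    proof (rule sum_mono)
      fix l assume l: "l \<in> I"
      show "(\<Sum>j=1..k. \<bar>\<phi> l (y j)\<bar>) \<le> C * R"
        unfolding y_def R_def
        by (rule sum_abs_multiadditive_le[OF n E]) (use add bd C x l in blast)+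
    qed
    also have "\<dots> \<le> (card I * C + 1) * R" using R by (simp add: algebra_simps)
    finally have "(\<Sum>j=1..k. vnorm F (T (y j))) \<le> (card I * C + 1) * R" .
    moreover have "0 \<le> (\<Sum>j=1..k. vnorm F (T (y j)))" by (intro sum_nonneg nn)
    ultimately show "(\<Sum>j=1..k. vnorm F (T (\<lambda>i\<in>{1..n}. x i j)) powr 1) powr (1 / 1)
        \<le> (card I * C + 1) * (\<Prod>i=1..n. rad_norm (E i) k (x i))"
      unfolding R_def[symmetric] y_def[symmetric] using nn by (simp add: sum_nonneg)
  qed (use C in \<open>auto intro: add_nonneg_pos\<close>)
qed

lemma finite_rank_cotype_2:
  fixes E :: "nat \<Rightarrow> ('k::rc_field, 'a) nvs" and F :: "('k, 'b) nvs"
  assumes E: "normed_vs (E 1)" and F: "normed_vs F"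
    and T: "T \<in> continuous_multilinear_ops 1 E F" and fr: "finite_rank 1 E F T"
  shows "has_cotype 2 1 E F T"
proof -
  interpret F: normed_vs F by fact
  let ?P = "\<Pi>\<^sub>E i\<in>{1..1::nat}. carrier (E i)"
  have E': "normed_vs (E i)" if "i \<in> {1..1}" for i using E that by simp
  have lin: "multilinear_op 1 E F T" using T by (simp add: continuous_multilinear_ops_def)
  obtain I :: "('b \<times> 'k) set" and \<phi> :: "'b \<times> 'k \<Rightarrow> (nat \<Rightarrow> 'a) \<Rightarrow> real" and C :: real where I: "finite I" and C: "0 \<le> C"
    and add: "\<forall>l\<in>I. multiadditive 1 E (\<phi> l)"
    and bd: "\<forall>l\<in>I. \<forall>x \<in> ?P. \<bar>\<phi> l x\<bar> \<le> C * (\<Prod>i=1..1. vnorm (E i) (x i))"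
    and dom: "\<forall>x \<in> ?P. vnorm F (T x) \<le> (\<Sum>l\<in>I. \<bar>\<phi> l x\<bar>)"
    by (rule finite_rank_dominated[OF _ E' F T fr]) auto
  define p :: "'a \<Rightarrow> nat \<Rightarrow> 'a" where "p u = (\<lambda>i\<in>{1..1}. u)" for u
  have p: "p u \<in> ?P" if "u \<in> carrier (E 1)" for u using that by (auto simp: p_def)
  have p1: "(p u)(1 := v) = p v" and p2: "p u 1 = u" for u v by (auto simp: p_def fun_eq_iff)
  show ?thesis
    unfolding has_cotype_def
  proof (intro conjI exI[of _ "card I * C + 1"] allI impI)
    fix k :: nat and x assume k: "k \<ge> 1" and x': "\<forall>i\<in>{1..1}. \<forall>j\<in>{1..k}. x i j \<in> carrier (E i)"
    have x: "x 1 j \<in> carrier (E 1)" if "j \<in> {1..k}" for j using x' that by auto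
    define R where "R = rad_norm (E 1) k (x 1)"
    have R: "0 \<le> R"
      unfolding R_def by (rule normed_vs.rad_norm_nonneg[OF E x])
    have nn: "0 \<le> vnorm F (T (p (x 1 j)))" if "j \<in> {1..k}" for j
    proof (rule F.vnorm_nonneg)
      show "T (p (x 1 j)) \<in> carrier F" by (rule multilinear_op_closed[OF lin p[OF x[OF that]]])
    qed
    have "(\<Sum>j=1..k. (vnorm F (T (p (x 1 j))))\<^sup>2) \<le> (\<Sum>j=1..k. \<Sum>l\<in>I. (\<phi> l (p (x 1 j)))\<^sup>2 * card I)"
    proof (rule sum_mono)
      fix j assume j: "j \<in> {1..k}"
      have "(vnorm F (T (p (x 1 j))))\<^sup>2 \<le> (\<Sum>l\<in>I. \<bar>\<phi> l (p (x 1 j))\<bar>)\<^sup>2"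
        by (rule power_mono) (use dom p[OF x[OF j]] nn[OF j] in auto)
      \<comment> \<open>Squaring a sum of \<open>card I\<close> terms costs one factor
        \<open>card I\<close>, and adding up the forms costs another; the square root below turns
        them into a single \<open>card I\<close>.\<close>
      also have "\<dots> \<le> (\<Sum>l\<in>I. \<bar>\<phi> l (p (x 1 j))\<bar>\<^sup>2) * card I"
        by (rule sum_squared_le_sum_of_squares)
      finally show "(vnorm F (T (p (x 1 j))))\<^sup>2 \<le> (\<Sum>l\<in>I. (\<phi> l (p (x 1 j)))\<^sup>2 * card I)"
        by (simp add: sum_distrib_right)
    qed
    also have "\<dots> = (\<Sum>l\<in>I. \<Sum>j=1..k. (\<phi> l (p (x 1 j)))\<^sup>2 * card I)" by (rule sum.swap)
    also have "\<dots> \<le> (\<Sum>l\<in>I. (C * R)\<^sup>2 * card I)"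
    proof (rule sum_mono)
      fix l assume l: "l \<in> I"
      have "(\<Sum>j=1..k. (\<phi> l (p (x 1 j)))\<^sup>2) \<le> (C * R)\<^sup>2"
        unfolding R_def
      proof (rule sum_sq_additive_le[OF E _ _ x])
        fix u v assume uv: "u \<in> carrier (E 1)" "v \<in> carrier (E 1)"
        have "\<phi> l ((p u)(1 := u \<oplus>\<^bsub>E 1\<^esub> v)) = \<phi> l ((p u)(1 := u)) + \<phi> l ((p u)(1 := v))"
          using add l p[OF uv(1)] uv unfolding multiadditive_def by auto
        then show "\<phi> l (p (u \<oplus>\<^bsub>E 1\<^esub> v)) = \<phi> l (p u) + \<phi> l (p v)"
          unfolding p1 .
      next
        fix u assume u: "u \<in> carrier (E 1)"
        have "\<bar>\<phi> l (p u)\<bar> \<le> C * (\<Prod>i=1..1. vnorm (E i) (p u i))"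
          using bd l p[OF u] by blast
        then show "\<bar>\<phi> l (p u)\<bar> \<le> C * vnorm (E 1) u" by (simp add: p2[simplified])
      qed
      then show "(\<Sum>j=1..k. (\<phi> l (p (x 1 j)))\<^sup>2 * card I) \<le> (C * R)\<^sup>2 * card I"
        by (simp add: mult_right_mono flip: sum_distrib_right)
    qed
    also have "\<dots> = (card I * C * R)\<^sup>2" by (simp add: power2_eq_square)
    finally have "sqrt (\<Sum>j=1..k. (vnorm F (T (p (x 1 j))))\<^sup>2) \<le> card I * C * R"
      using C R by (intro real_le_lsqrt) (auto intro: sum_nonneg)
    also have "\<dots> \<le> (card I * C + 1) * R" using R by (simp add: algebra_simps)
    finally have "sqrt (\<Sum>j=1..k. (vnorm F (T (p (x 1 j))))\<^sup>2) \<le> (card I * C + 1) * R" .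
    moreover have "(\<Sum>j=1..k. vnorm F (T (p (x 1 j))) powr 2) = (\<Sum>j=1..k. (vnorm F (T (p (x 1 j))))\<^sup>2)"
      by (rule sum.cong) (use nn in auto)
    moreover have "p (x 1 j) = (\<lambda>i\<in>{1..1}. x i j)" for j by (auto simp: p_def fun_eq_iff)
    ultimately show "(\<Sum>j=1..k. vnorm F (T (\<lambda>i\<in>{1..1}. x i j)) powr 2) powr (1 / 2)
        \<le> (card I * C + 1) * (\<Prod>i=1..1. rad_norm (E i) k (x i))"
      by (simp add: R_def powr_half_sqrt sum_nonneg)
  qed (use C in \<open>auto intro: add_nonneg_pos\<close>)
qed

section \<open>Sequence spaces\<close>

text \<open>In a T1 space a point is determined by the basic open sets that contain it, hence by a
  set of indices into a countable basis.\<close>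

lemma second_countable_lepoll_nat_sets:
  "(UNIV :: 'b::{second_countable_topology, t1_space} set) \<lesssim> (UNIV :: nat set set)"
proof -
  obtain B :: "'b set set" where B: "countable B" "topological_basis B"
    using ex_countable_basis by blast
  have "inj (\<lambda>x. {n. x \<in> from_nat_into B n})"
  proof (rule injI, rule ccontr)
    fix x y :: 'b
    assume eq: "{n. x \<in> from_nat_into B n} = {n. y \<in> from_nat_into B n}" and "x \<noteq> y"
    then obtain U where U: "open U" "x \<in> U" "y \<notin> U" using t1_space by blast
    obtain V where V: "V \<in> B" "x \<in> V" "V \<subseteq> U" by (rule topological_basisE[OF B(2) U(1,2)])
    obtain n where "from_nat_into B n = V" using from_nat_into_surj[OF B(1) V(1)] by blast
    then show False using eq V U by blast
  qed
  then show ?thesis unfolding lepoll_def by blast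
qed

text \<open>A countable power of the scalar field is again second countable. This supplies the
  injection that carries the sequence spaces into the given type.\<close>

lemma sequences_lepoll_reals:
  "(UNIV :: (nat \<Rightarrow> 'k::{second_countable_topology, metric_space}) set) \<lesssim> (UNIV :: real set)"
  by (rule lepoll_trans[OF second_countable_lepoll_nat_sets eqpoll_imp_lepoll[OF nat_sets_eqpoll_reals]])

text \<open>A supremum of finite sums covers the maximum norm and the summation norm alike, so that
  the norm axioms and completeness are proved once for both.\<close>

definition seq_norm :: "(nat \<Rightarrow> nat set) \<Rightarrow> (nat \<Rightarrow> 'k::real_normed_field) \<Rightarrow> real" where
  "seq_norm S x = (SUP m. \<Sum>j\<in>S m. norm (x j))"

definition seq_bounded :: "(nat \<Rightarrow> nat set) \<Rightarrow> (nat \<Rightarrow> 'k::real_normed_field) set" where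
  "seq_bounded S = {x. bdd_above (range (\<lambda>m. \<Sum>j\<in>S m. norm (x j)))}"

text \<open>The singletons \<open>S m = {m}\<close> give the space of bounded sequences, the initial segments
  \<open>S m = {..m}\<close> give the space of absolutely summable sequences.\<close>

definition seq_space ::
  "((nat \<Rightarrow> 'k::rc_field) \<Rightarrow> 'a) \<Rightarrow> (nat \<Rightarrow> nat set) \<Rightarrow> ('k, 'a) nvs" where
  "seq_space g S = \<lparr>carrier = g ` seq_bounded S, monoid.mult = (\<lambda>_ _. undefined), one = undefined,
     zero = g (\<lambda>_. 0), add = (\<lambda>a b. g (\<lambda>j. the_inv g a j + the_inv g b j)),
     smult = (\<lambda>c a. g (\<lambda>j. c * the_inv g a j)), vnorm = (\<lambda>a. seq_norm S (the_inv g a))\<rparr>"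

lemma seq_normI:
  assumes "\<And>m. (\<Sum>j\<in>S m. norm (x j)) \<le> C"
  shows "x \<in> seq_bounded S" "seq_norm S x \<le> C"
proof -
  show "x \<in> seq_bounded S" unfolding seq_bounded_def using assms by (auto intro!: bdd_aboveI)
  show "seq_norm S x \<le> C" unfolding seq_norm_def by (rule cSUP_least) (use assms in auto)
qed

lemma seq_norm_upper: "x \<in> seq_bounded S \<Longrightarrow> (\<Sum>j\<in>S m. norm (x j)) \<le> seq_norm S x"
  unfolding seq_norm_def seq_bounded_def by (rule cSUP_upper) auto

lemma seq_norm_nonneg: "x \<in> seq_bounded S \<Longrightarrow> 0 \<le> seq_norm S x"
  by (rule order.trans[OF sum_nonneg seq_norm_upper]) auto

lemma seq_norm_zero: "seq_norm S (\<lambda>_. 0) = 0"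
  by (simp add: seq_norm_def)

lemma seq_norm_triangle:
  assumes "x \<in> seq_bounded S" "y \<in> seq_bounded S"
  shows "(\<lambda>j. x j + y j) \<in> seq_bounded S" "seq_norm S (\<lambda>j. x j + y j) \<le> seq_norm S x + seq_norm S y"
proof -
  have "(\<Sum>j\<in>S m. norm (x j + y j)) \<le> seq_norm S x + seq_norm S y" for m
  proof -
    have "(\<Sum>j\<in>S m. norm (x j + y j)) \<le> (\<Sum>j\<in>S m. norm (x j) + norm (y j))"
      by (intro sum_mono norm_triangle_ineq)
    also have "\<dots> \<le> seq_norm S x + seq_norm S y"
      unfolding sum.distrib by (intro add_mono seq_norm_upper assms)
    finally show ?thesis .
  qed
  from seq_normI[of "\<lambda>j. x j + y j" S, OF this]
  show "(\<lambda>j. x j + y j) \<in> seq_bounded S" "seq_norm S (\<lambda>j. x j + y j) \<le> seq_norm S x + seq_norm S y" .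
qed

lemma seq_norm_scale:
  assumes x: "x \<in> seq_bounded S"
  shows "(\<lambda>j. c * x j) \<in> seq_bounded S" "seq_norm S (\<lambda>j. c * x j) = norm c * seq_norm S x"
proof -
  have le: "(\<Sum>j\<in>S m. norm (c * y j)) \<le> norm c * seq_norm S y" if "y \<in> seq_bounded S" for c :: 'a and y m
    unfolding norm_mult sum_distrib_left[symmetric] by (intro mult_left_mono seq_norm_upper that) simp
  note 1 = seq_normI[of "\<lambda>j. c * x j" S, OF le[OF x]]
  show cx: "(\<lambda>j. c * x j) \<in> seq_bounded S" by (rule 1(1))
  show "seq_norm S (\<lambda>j. c * x j) = norm c * seq_norm S x"
  proof (cases "c = 0")
    case True
    then show ?thesis by (simp add: seq_norm_zero)
  next
    case False
    \<comment> \<open>The reverse inequality is the upper estimate applied to scaling back by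
      \<open>inverse c\<close>.\<close>
    have "seq_norm S (\<lambda>j. inverse c * (c * x j)) \<le> norm (inverse c) * seq_norm S (\<lambda>j. c * x j)"
      by (rule seq_normI(2)) (rule le[OF cx])
    then have "norm c * seq_norm S x \<le> seq_norm S (\<lambda>j. c * x j)"
      using False by (simp add: norm_divide field_simps)
    with 1(2) show ?thesis by simp
  qed
qed

text \<open>Together, \<open>finite_S\<close> and \<open>cover\<close> bound every coordinate by the
  norm. This gives definiteness, and it makes norm-Cauchy sequences Cauchy in each
  coordinate.\<close>

locale sequence_space =
  fixes g :: "(nat \<Rightarrow> 'k::rc_field) \<Rightarrow> 'a" and S :: "nat \<Rightarrow> nat set"
  assumes inj: "inj g" and finite_S: "finite (S m)" and cover: "\<exists>m. j \<in> S m"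
begin

abbreviation "X \<equiv> seq_space g S"

lemma inv_g [simp]: "the_inv g (g x) = x"
  by (rule the_inv_f_f[OF inj])

lemma carrier_X: "carrier X = g ` seq_bounded S"
  and zero_X: "\<zero>\<^bsub>X\<^esub> = g (\<lambda>_. 0)"
  and add_X: "a \<oplus>\<^bsub>X\<^esub> b = g (\<lambda>j. the_inv g a j + the_inv g b j)"
  and smult_X: "c \<odot>\<^bsub>X\<^esub> a = g (\<lambda>j. c * the_inv g a j)"
  and vnorm_X: "vnorm X a = seq_norm S (the_inv g a)"
  by (simp_all add: seq_space_def)

lemma norm_le_seq_norm:
  assumes "x \<in> seq_bounded S"
  shows "norm (x j) \<le> seq_norm S x"
proof -
  obtain m where "j \<in> S m" using cover by blast
  then have "norm (x j) \<le> (\<Sum>j\<in>S m. norm (x j))" by (intro member_le_sum finite_S) auto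
  also have "\<dots> \<le> seq_norm S x" by (rule seq_norm_upper[OF assms])
  finally show ?thesis .
qed

lemma abelian_group_X: "abelian_group X"
proof (rule abelian_groupI)
  show "\<zero>\<^bsub>X\<^esub> \<in> carrier X"
    unfolding zero_X carrier_X by (intro imageI seq_normI(1)[of _ _ 0]) simp
  fix a assume "a \<in> carrier X"
  then obtain x where x: "x \<in> seq_bounded S" "a = g x" by (auto simp: carrier_X)
  show "\<exists>b\<in>carrier X. b \<oplus>\<^bsub>X\<^esub> a = \<zero>\<^bsub>X\<^esub>"
  proof (rule bexI)
    show "g (\<lambda>j. - 1 * x j) \<in> carrier X"
      unfolding carrier_X by (rule imageI, rule seq_norm_scale(1)[OF x(1)])
    show "g (\<lambda>j. - 1 * x j) \<oplus>\<^bsub>X\<^esub> a = \<zero>\<^bsub>X\<^esub>" by (simp add: add_X zero_X x(2))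
  qed
qed (auto simp: carrier_X add_X zero_X add_ac intro!: imageI seq_norm_triangle(1))

lemma normed_vs_X: "normed_vs X"
proof (intro normed_vs.intro normed_vs_axioms.intro)
  show "Module.module (scalars :: 'k ring) X"
    by (rule moduleI[OF scalars_cring abelian_group_X])
      (auto simp: carrier_X smult_X add_X scalars_def algebra_simps intro!: imageI seq_norm_scale(1))
  fix a assume "a \<in> carrier X"
  then obtain x where x: "x \<in> seq_bounded S" and a: "a = g x" by (auto simp: carrier_X)
  show "0 \<le> vnorm X a" using seq_norm_nonneg[OF x] by (simp add: vnorm_X a)
  show "vnorm X a = 0 \<longleftrightarrow> a = \<zero>\<^bsub>X\<^esub>"
  proof
    assume "vnorm X a = 0"
    then have "x = (\<lambda>_. 0)" using norm_le_seq_norm[OF x] by (auto simp: vnorm_X a)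
    then show "a = \<zero>\<^bsub>X\<^esub>" by (simp add: a zero_X)
  qed (simp add: vnorm_X zero_X seq_norm_zero)
  show "vnorm X (c \<odot>\<^bsub>X\<^esub> a) = norm c * vnorm X a" for c
    by (simp add: vnorm_X smult_X a seq_norm_scale(2)[OF x])
  fix b assume "b \<in> carrier X"
  then obtain y where y: "y \<in> seq_bounded S" and b: "b = g y" by (auto simp: carrier_X)
  show "vnorm X (a \<oplus>\<^bsub>X\<^esub> b) \<le> vnorm X a + vnorm X b"
    by (simp add: vnorm_X add_X a b seq_norm_triangle(2)[OF x y])
qed

sublocale normed_vs X
  by (rule normed_vs_X)

lemma vdist_X:
  assumes "a \<in> carrier X" "b \<in> carrier X"
  shows "vdist X a b = seq_norm S (\<lambda>j. the_inv g a j - the_inv g b j)"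
  using assms by (simp add: vdist_def a_minus_def minus_eq_smult vnorm_X add_X smult_X)

lemma seq_bounded_diff: "x \<in> seq_bounded S \<Longrightarrow> y \<in> seq_bounded S \<Longrightarrow> (\<lambda>j. x j - y j) \<in> seq_bounded S"
  using seq_norm_triangle(1)[of x S "\<lambda>j. - 1 * y j"] seq_norm_scale(1)[of y S "-1"] by simp

text \<open>Coordinatewise limits exist by completeness of the scalars. The Cauchy estimate is
  inherited by each finite sum, survives the limit there, and only then is the supremum
  taken.\<close>

lemma banach_space_X: "banach_space X"
proof -
  interpret M: Metric_space "carrier X" "vdist X" by (rule Metric_space_vdist)
  have "\<exists>a. limitin M.mtopology \<sigma> a sequentially" if C: "M.MCauchy \<sigma>" for \<sigma>
  proof -
    define x where "x n = the_inv g (\<sigma> n)" for n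
    have \<sigma>: "\<sigma> n \<in> carrier X" for n using C unfolding M.MCauchy_def by blast
    have x: "x n \<in> seq_bounded S" for n using \<sigma>[of n] by (auto simp: x_def carrier_X)
    have Cx: "\<exists>N. \<forall>n\<ge>N. \<forall>m\<ge>N. seq_norm S (\<lambda>j. x n j - x m j) < e" if e: "e > 0" for e
    proof -
      obtain N where "\<forall>n n'. N \<le> n \<longrightarrow> N \<le> n' \<longrightarrow> vdist X (\<sigma> n) (\<sigma> n') < e"
        using C[unfolded M.MCauchy_def, THEN conjunct2, rule_format, OF e] by blast
      then show ?thesis unfolding vdist_X[OF \<sigma> \<sigma>] x_def by blast
    qed
    have "\<exists>l. (\<lambda>n. x n j) \<longlonglongrightarrow> l" for j
    proof -
      have "Cauchy (\<lambda>n. x n j)"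
      proof (rule metric_CauchyI)
        fix e :: real assume "e > 0"
        then obtain N where N: "\<forall>n\<ge>N. \<forall>m\<ge>N. seq_norm S (\<lambda>j. x n j - x m j) < e" using Cx by blast
        have "dist (x m j) (x n j) < e" if "m \<ge> N" "n \<ge> N" for m n
          using N[rule_format, OF that] norm_le_seq_norm[OF seq_bounded_diff[OF x x], of m j n]
          unfolding dist_norm by linarith
        then show "\<exists>N. \<forall>m\<ge>N. \<forall>n\<ge>N. dist (x m j) (x n j) < e" by blast
      qed
      then show ?thesis by (simp add: Cauchy_convergent_iff convergent_def)
    qed
    then have "\<forall>j. \<exists>l. (\<lambda>n. x n j) \<longlonglongrightarrow> l" by blast
    from choice[OF this] obtain y where y: "\<And>j. (\<lambda>n. x n j) \<longlonglongrightarrow> y j" by blast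
    have lim: "(\<lambda>j. x n j - y j) \<in> seq_bounded S \<and> seq_norm S (\<lambda>j. x n j - y j) \<le> e"
      if N: "\<forall>n\<ge>N. \<forall>m\<ge>N. seq_norm S (\<lambda>j. x n j - x m j) < e" and n: "n \<ge> N" for N n e
    proof -
      have "(\<Sum>j\<in>S m. norm (x n j - y j)) \<le> e" for m
      proof (rule LIMSEQ_le_const2)
        show "(\<lambda>i. \<Sum>j\<in>S m. norm (x n j - x i j)) \<longlonglongrightarrow> (\<Sum>j\<in>S m. norm (x n j - y j))"
          by (intro tendsto_intros y)
        have "(\<Sum>j\<in>S m. norm (x n j - x i j)) \<le> e" if "i \<ge> N" for i
          using N[rule_format, OF n that] seq_norm_upper[OF seq_bounded_diff[OF x x], of n i m]
          by linarith
        then show "\<exists>N. \<forall>i\<ge>N. (\<Sum>j\<in>S m. norm (x n j - x i j)) \<le> e" by blast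
      qed
      from seq_normI[of "\<lambda>j. x n j - y j" S, OF this] show ?thesis by blast
    qed
    obtain N0 where N0: "\<forall>n\<ge>N0. \<forall>m\<ge>N0. seq_norm S (\<lambda>j. x n j - x m j) < 1" using Cx[of 1] by auto
    \<comment> \<open>The limit is recovered as a difference of two bounded sequences.\<close>
    have "(\<lambda>j. x N0 j - (x N0 j - y j)) \<in> seq_bounded S"
      by (rule seq_bounded_diff[OF x]) (use lim[OF N0 order_refl] in blast)
    then have yb: "y \<in> seq_bounded S" by simp
    then have gy: "g y \<in> carrier X" by (simp add: carrier_X)
    have "limitin M.mtopology \<sigma> (g y) sequentially"
      unfolding M.limit_metric_sequentially
    proof (intro conjI allI impI gy)
      fix e :: real assume "e > 0"
      then obtain N where N: "\<forall>n\<ge>N. \<forall>m\<ge>N. seq_norm S (\<lambda>j. x n j - x m j) < e / 2"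
        using Cx[of "e / 2"] by auto
      have "\<sigma> n \<in> carrier X \<and> vdist X (\<sigma> n) (g y) < e" if "n \<ge> N" for n
      proof -
        have "seq_norm S (\<lambda>j. x n j - y j) \<le> e / 2" using lim[OF N that] by blast
        then show ?thesis using \<sigma> \<open>e > 0\<close> by (simp add: vdist_X[OF \<sigma> gy] x_def)
      qed
      then show "\<exists>N. \<forall>n\<ge>N. \<sigma> n \<in> carrier X \<and> vdist X (\<sigma> n) (g y) < e" by blast
    qed
    then show ?thesis by blast
  qed
  then show ?thesis
    unfolding banach_space_def M.mcomplete_def using normed_vs_X by blast
qed

lemma inv_g_finsum:
  "finite A \<Longrightarrow> v \<in> A \<rightarrow> carrier X \<Longrightarrow> the_inv g (\<Oplus>\<^bsub>X\<^esub>j\<in>A. v j) = (\<lambda>m. \<Sum>j\<in>A. the_inv g (v j) m)"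
proof (induction A rule: finite_induct)
  case (insert a A)
  then show ?case by (simp add: Pi_def M.finsum_insert add_X)
qed (simp add: zero_X)

end

section \<open>Rademacher norms of unit vectors\<close>

definition unit_seq :: "nat \<Rightarrow> nat \<Rightarrow> 'k::rc_field" where
  "unit_seq j m = (if m = j then 1 else 0)"

lemma l1_space: "inj g \<Longrightarrow> sequence_space g (\<lambda>m. {..m})"
  by unfold_locales auto

lemma linf_space: "inj g \<Longrightarrow> sequence_space g (\<lambda>m. {m})"
  by unfold_locales auto

lemma unit_seq_l1:
  shows "(unit_seq j :: nat \<Rightarrow> 'k::rc_field) \<in> seq_bounded (\<lambda>m. {..m})"
    and "seq_norm (\<lambda>m. {..m}) (unit_seq j :: nat \<Rightarrow> 'k) \<le> 1"
proof -
  have "(\<Sum>i\<le>m. norm (unit_seq j i :: 'k)) \<le> 1" for m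
    by (simp add: unit_seq_def if_distrib[of norm] cong: if_cong)
  from seq_normI[of "unit_seq j" "\<lambda>m. {..m}", OF this]
  show "(unit_seq j :: nat \<Rightarrow> 'k) \<in> seq_bounded (\<lambda>m. {..m})" "seq_norm (\<lambda>m. {..m}) (unit_seq j :: nat \<Rightarrow> 'k) \<le> 1" .
qed

lemma unit_seq_linf:
  shows "(unit_seq j :: nat \<Rightarrow> 'k::rc_field) \<in> seq_bounded (\<lambda>m. {m})"
    and "seq_norm (\<lambda>m. {m}) (unit_seq j :: nat \<Rightarrow> 'k) = 1"
proof -
  have "(\<Sum>i\<in>{m}. norm (unit_seq j i :: 'k)) \<le> 1" for m by (simp add: unit_seq_def)
  note 1 = seq_normI[of "unit_seq j" "\<lambda>m. {m}", OF this]
  show "(unit_seq j :: nat \<Rightarrow> 'k) \<in> seq_bounded (\<lambda>m. {m})" by (rule 1(1))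
  then have "(\<Sum>i\<in>{j}. norm (unit_seq j i :: 'k)) \<le> seq_norm (\<lambda>m. {m}) (unit_seq j :: nat \<Rightarrow> 'k)"
    by (rule seq_norm_upper)
  then show "seq_norm (\<lambda>m. {m}) (unit_seq j :: nat \<Rightarrow> 'k) = 1"
    using 1(2) by (simp add: unit_seq_def)
qed

lemma (in normed_vs) rad_norm_le:
  assumes "\<And>j. j \<in> {1..k} \<Longrightarrow> x j \<in> carrier X"
    and "\<And>s. s \<in> signs k \<Longrightarrow> vnorm X (sign_sum X k x s) \<le> C" and "0 \<le> C"
  shows "rad_norm X k x \<le> C"
proof -
  have "(\<Sum>s\<in>signs k. (vnorm X (sign_sum X k x s))\<^sup>2) \<le> (\<Sum>s\<in>signs k. C\<^sup>2)"
    by (intro sum_mono power_mono assms(2) vnorm_nonneg sign_sum_closed assms(1))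
  then have "(\<Sum>s\<in>signs k. (vnorm X (sign_sum X k x s))\<^sup>2) / 2 ^ k \<le> C\<^sup>2"
    by (simp add: card_signs field_simps)
  moreover have "rad_norm X k x = sqrt ((\<Sum>s\<in>signs k. (vnorm X (sign_sum X k x s))\<^sup>2) / 2 ^ k)"
    by (rule rad_norm_eq) (rule assms(1))
  ultimately show ?thesis using assms(3) by (simp add: real_le_lsqrt)
qed

text \<open>The triangle inequality for \<open>k\<close> vectors of norm at most 1, uniformly in the
  signs.\<close>

lemma rad_norm_l1_unit_seq:
  fixes g :: "(nat \<Rightarrow> 'k::rc_field) \<Rightarrow> 'a"
  assumes "inj g"
  shows "rad_norm (seq_space g (\<lambda>m. {..m})) k (\<lambda>j. g (unit_seq j)) \<le> k"
proof -
  interpret sequence_space g "\<lambda>m. {..m}" by (rule l1_space[OF assms])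
  have cl: "g (unit_seq j) \<in> carrier X" for j by (simp add: carrier_X unit_seq_l1)
  show ?thesis
  proof (rule rad_norm_le[where x = "\<lambda>j. g (unit_seq j)"], rule cl)
    fix s assume s: "s \<in> signs k"
    have "vnorm X (sign_sum X k (\<lambda>j. g (unit_seq j)) s) \<le> (\<Sum>j=1..k. vnorm X (of_real (s j) \<odot>\<^bsub>X\<^esub> g (unit_seq j)))"
      unfolding sign_sum_def using cl by (intro vnorm_finsum_le) auto
    also have "\<dots> \<le> (\<Sum>j=1..k. 1)"
    proof (rule sum_mono)
      fix j assume "j \<in> {1..k}"
      then have "\<bar>s j\<bar> = 1" using signs_cases[OF s] by fastforce
      then have "vnorm X (of_real (s j) \<odot>\<^bsub>X\<^esub> g (unit_seq j)) = seq_norm (\<lambda>m. {..m}) (unit_seq j :: nat \<Rightarrow> 'k)"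
        using cl by (simp add: vnorm_smult) (simp add: vnorm_X)
      then show "vnorm X (of_real (s j) \<odot>\<^bsub>X\<^esub> g (unit_seq j)) \<le> 1" by (simp only: unit_seq_l1(2))
    qed
    finally show "vnorm X (sign_sum X k (\<lambda>j. g (unit_seq j)) s) \<le> k" by simp
  qed simp
qed

text \<open>Unit vectors have disjoint supports, so a signed sum has only the coordinates 1, -1 and
  0.\<close>

lemma rad_norm_linf_unit_seq:
  fixes g :: "(nat \<Rightarrow> 'k::rc_field) \<Rightarrow> 'a"
  assumes "inj g"
  shows "rad_norm (seq_space g (\<lambda>m. {m})) k (\<lambda>j. g (unit_seq j)) \<le> 1"
proof -
  interpret sequence_space g "\<lambda>m. {m}" by (rule linf_space[OF assms])
  have cl: "g (unit_seq j) \<in> carrier X" for j by (simp add: carrier_X unit_seq_linf)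
  show ?thesis
  proof (rule rad_norm_le[where x = "\<lambda>j. g (unit_seq j)"], rule cl)
    fix s assume s: "s \<in> signs k"
    have "the_inv g (sign_sum X k (\<lambda>j. g (unit_seq j)) s) = (\<lambda>m. \<Sum>j=1..k. of_real (s j) * unit_seq j m)"
    proof -
      have "of_real (s j) \<odot>\<^bsub>X\<^esub> g (unit_seq j) \<in> carrier X" for j using cl by (rule smult_closed')
      then have "the_inv g (sign_sum X k (\<lambda>j. g (unit_seq j)) s)
          = (\<lambda>m. \<Sum>j=1..k. the_inv g (of_real (s j) \<odot>\<^bsub>X\<^esub> g (unit_seq j)) m)"
        unfolding sign_sum_def by (intro inv_g_finsum) auto
      then show ?thesis by (simp add: smult_X)
    qed
    also have "\<dots> = (\<lambda>m. if m \<in> {1..k} then of_real (s m) else 0)"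
      by (simp add: unit_seq_def fun_eq_iff if_distrib[of "\<lambda>x. _ * x"] cong: if_cong)
    finally have eq: "the_inv g (sign_sum X k (\<lambda>j. g (unit_seq j)) s) = \<dots>" .
    show "vnorm X (sign_sum X k (\<lambda>j. g (unit_seq j)) s) \<le> 1"
      unfolding vnorm_X eq by (rule seq_normI(2)) (use signs_cases[OF s] in force)
  qed simp
qed

section \<open>The diagonal form\<close>

text \<open>Telescoping: one factor is exchanged at a time, at the cost of \<open>\<delta>\<close>
  times a product of factors bounded by \<open>R\<close>.\<close>

lemma norm_prod_diff_le:
  fixes z w :: "'i \<Rightarrow> 'k::real_normed_field" and R \<delta> :: real
  assumes "finite K" "1 \<le> R" "0 \<le> \<delta>"
    "\<forall>i\<in>K. norm (z i) \<le> R \<and> norm (w i) \<le> R \<and> norm (z i - w i) \<le> \<delta>"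
  shows "norm ((\<Prod>i\<in>K. z i) - (\<Prod>i\<in>K. w i)) \<le> R ^ card K * (card K * \<delta>)"
  using assms(1,4)
proof (induction K rule: finite_induct)
  case (insert a K)
  let ?c = "card K"
  have IH: "norm ((\<Prod>i\<in>K. z i) - (\<Prod>i\<in>K. w i)) \<le> R ^ ?c * (?c * \<delta>)"
    by (rule insert.IH) (use insert.prems in simp)
  have "norm (\<Prod>i\<in>K. z i) \<le> (\<Prod>i\<in>K. R)"
    unfolding prod_norm[symmetric] by (rule prod_mono) (use insert.prems in auto)
  then have z: "norm (\<Prod>i\<in>K. z i) \<le> R ^ ?c" by simp
  have "(\<Prod>i\<in>insert a K. z i) - (\<Prod>i\<in>insert a K. w i)
      = (z a - w a) * (\<Prod>i\<in>K. z i) + w a * ((\<Prod>i\<in>K. z i) - (\<Prod>i\<in>K. w i))"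
    using insert.hyps by (simp add: algebra_simps)
  then have "norm ((\<Prod>i\<in>insert a K. z i) - (\<Prod>i\<in>insert a K. w i))
      \<le> norm ((z a - w a) * (\<Prod>i\<in>K. z i)) + norm (w a * ((\<Prod>i\<in>K. z i) - (\<Prod>i\<in>K. w i)))"
    by (simp only: norm_triangle_ineq)
  also have "\<dots> \<le> \<delta> * R ^ ?c + R * (R ^ ?c * (?c * \<delta>))"
    unfolding norm_mult
    by (rule add_mono; rule mult_mono) (use z IH insert.prems assms(2,3) in auto)
  \<comment> \<open>The surplus power of \<open>R\<close>, available as \<open>1 \<le> R\<close>,
    gives both summands the same power.\<close>
  also have "\<dots> \<le> \<delta> * R ^ Suc ?c + R * (R ^ ?c * (?c * \<delta>))"
  proof -
    have "R ^ ?c \<le> R ^ Suc ?c" using assms(2) by (intro power_increasing) auto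
    then show ?thesis using assms(3) by (simp only: add_le_cancel_right mult_left_mono)
  qed
  also have "\<dots> = R ^ card (insert a K) * (card (insert a K) * \<delta>)"
    using insert.hyps by (simp add: algebra_simps)
  finally show ?case .
qed simp

lemma l1_summable:
  assumes "x \<in> seq_bounded (\<lambda>m. {..m})"
  shows "summable (\<lambda>m. norm (x m))" "(\<Sum>m. norm (x m)) \<le> seq_norm (\<lambda>m. {..m}) x"
proof -
  have le: "(\<Sum>m<N. norm (x m)) \<le> seq_norm (\<lambda>m. {..m}) x" for N
  proof -
    have "(\<Sum>m<N. norm (x m)) \<le> (\<Sum>m\<le>N. norm (x m))" by (rule sum_mono2) auto
    also have "\<dots> \<le> seq_norm (\<lambda>m. {..m}) x" using seq_norm_upper[OF assms, of N] by simp
    finally show ?thesis .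
  qed
  show s: "summable (\<lambda>m. norm (x m))"
    by (rule summableI_nonneg_bounded[OF _ le]) simp
  show "(\<Sum>m. norm (x m)) \<le> seq_norm (\<lambda>m. {..m}) x"
    by (rule suminf_le_const[OF s le])
qed

locale diagonal_form =
  fixes g :: "(nat \<Rightarrow> 'k::rc_field) \<Rightarrow> 'a" and n :: nat
  assumes inj_g: "inj g" and n_pos: "1 \<le> n"
begin

sublocale l1: sequence_space g "\<lambda>m. {..m}" by (rule l1_space[OF inj_g])
sublocale linf: sequence_space g "\<lambda>m. {m}" by (rule linf_space[OF inj_g])

abbreviation "L1 \<equiv> seq_space g (\<lambda>m. {..m})"
abbreviation "Linf \<equiv> seq_space g (\<lambda>m. {m})"

definition E :: "nat \<Rightarrow> ('k, 'a) nvs" where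
  "E i = (if i = 1 then L1 else Linf)"

definition D :: "(nat \<Rightarrow> 'a) \<Rightarrow> 'k" where
  "D u = (\<Sum>m. \<Prod>i=1..n. the_inv g (u i) m)"

text \<open>The scalar field is not itself a space carried by the type \<open>'a\<close>, so the
  form is made vector-valued: its values multiply a fixed vector of norm 1, and the range stays
  one-dimensional.\<close>

definition T :: "(nat \<Rightarrow> 'a) \<Rightarrow> 'a" where
  "T u = D u \<odot>\<^bsub>Linf\<^esub> g (unit_seq 0)"

abbreviation "P \<equiv> \<Pi>\<^sub>E i\<in>{1..n}. carrier (E i)"

lemma banach_E: "banach_space (E i)" and normed_E: "normed_vs (E i)"
  by (simp_all add: E_def l1.banach_space_X linf.banach_space_X l1.normed_vs_X linf.normed_vs_X)

lemma e_closed: "g (unit_seq 0) \<in> carrier Linf"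
  by (simp add: linf.carrier_X unit_seq_linf)

lemma vnorm_e: "vnorm Linf (g (unit_seq 0)) = 1"
  by (simp add: linf.vnorm_X unit_seq_linf)

lemma coord_le: "a \<in> carrier (E i) \<Longrightarrow> norm (the_inv g a m) \<le> vnorm (E i) a"
  using l1.norm_le_seq_norm linf.norm_le_seq_norm
  by (auto simp: E_def l1.carrier_X linf.carrier_X l1.vnorm_X linf.vnorm_X split: if_splits)

lemma coord_1: "u \<in> P \<Longrightarrow> the_inv g (u 1) \<in> seq_bounded (\<lambda>m. {..m})"
proof -
  assume "u \<in> P"
  then have "u 1 \<in> carrier (E 1)" using n_pos by (auto simp: PiE_iff)
  then show ?thesis by (auto simp: E_def l1.carrier_X)
qed

lemma prod_split: "(\<Prod>i=1..n. f i) = f 1 * (\<Prod>i\<in>{2..n}. f i)" for f :: "nat \<Rightarrow> 'k"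
  using prod.atLeast_Suc_atMost[OF n_pos, of f] by (simp add: numeral_2_eq_2)

text \<open>The first variable is absolutely summable and the remaining factors are bounded
  uniformly in \<open>m\<close>.\<close>

lemma summable_D:
  assumes u: "u \<in> P"
  shows "summable (\<lambda>m. \<Prod>i=1..n. the_inv g (u i) m)"
proof (rule summable_comparison_test')
  define C where "C = (\<Prod>i\<in>{2..n}. vnorm (E i) (u i))"
  show "summable (\<lambda>m. norm (the_inv g (u 1) m) * C)"
    by (rule summable_mult2[OF l1_summable(1)[OF coord_1[OF u]]])
  fix m
  have "norm (\<Prod>i\<in>{2..n}. the_inv g (u i) m) \<le> C"
    unfolding C_def prod_norm[symmetric] using u by (intro prod_mono) (auto intro: coord_le)
  then show "norm (\<Prod>i=1..n. the_inv g (u i) m) \<le> norm (the_inv g (u 1) m) * C"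
    unfolding prod_split norm_mult by (intro mult_left_mono) auto
qed

text \<open>Isolates the varied factor in each term, so that linearity of the form becomes linearity
  of the series.\<close>

lemma prod_upd:
  assumes "i \<in> {1..n}"
  shows "(\<Prod>l=1..n. the_inv g ((u(i := a)) l) m) = the_inv g a m * (\<Prod>l\<in>{1..n} - {i}. the_inv g (u l) m)"
proof -
  have "(\<Prod>l\<in>{1..n} - {i}. the_inv g ((u(i := a)) l) m) = (\<Prod>l\<in>{1..n} - {i}. the_inv g (u l) m)"
    by (rule prod.cong) auto
  then show ?thesis
    using prod.remove[OF _ assms, of "\<lambda>l. the_inv g ((u(i := a)) l) m"] by simp
qed

lemma P_upd: "u \<in> P \<Longrightarrow> i \<in> {1..n} \<Longrightarrow> a \<in> carrier (E i) \<Longrightarrow> u(i := a) \<in> P"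
  by (auto simp: PiE_iff extensional_def)

lemma the_inv_add: "the_inv g (a \<oplus>\<^bsub>E i\<^esub> b) m = the_inv g a m + the_inv g b m"
  and the_inv_smult: "the_inv g (c \<odot>\<^bsub>E i\<^esub> a) m = c * the_inv g a m"
  by (simp_all add: E_def l1.add_X linf.add_X l1.smult_X linf.smult_X)

lemma D_add:
  assumes u: "u \<in> P" and i: "i \<in> {1..n}" and a: "a \<in> carrier (E i)" and b: "b \<in> carrier (E i)"
  shows "D (u(i := a \<oplus>\<^bsub>E i\<^esub> b)) = D (u(i := a)) + D (u(i := b))"
  using suminf_add[OF summable_D[OF P_upd[OF u i a]] summable_D[OF P_upd[OF u i b]]]
  unfolding D_def prod_upd[OF i] the_inv_add by (simp only: distrib_right)

lemma D_smult:
  assumes u: "u \<in> P" and i: "i \<in> {1..n}" and a: "a \<in> carrier (E i)"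
  shows "D (u(i := c \<odot>\<^bsub>E i\<^esub> a)) = c * D (u(i := a))"
  using suminf_mult[OF summable_D[OF P_upd[OF u i a]], of c]
  unfolding D_def prod_upd[OF i] the_inv_smult by (simp only: mult.assoc)

lemma multilinear_T: "multilinear_op n E Linf T"
  unfolding multilinear_op_def
proof (intro conjI ballI allI funcsetI)
  fix u show "T u \<in> carrier Linf" unfolding T_def by (rule linf.smult_closed'[OF e_closed])
next
  fix u i a b assume "u \<in> P" "i \<in> {1..n}" "a \<in> carrier (E i)" "b \<in> carrier (E i)"
  then show "T (u(i := a \<oplus>\<^bsub>E i\<^esub> b)) = T (u(i := a)) \<oplus>\<^bsub>Linf\<^esub> T (u(i := b))"
    unfolding T_def by (simp only: D_add linf.smult_add[OF e_closed])
next
  fix u i a c assume "u \<in> P" "i \<in> {1..n}" "a \<in> carrier (E i)"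
  then show "T (u(i := c \<odot>\<^bsub>E i\<^esub> a)) = c \<odot>\<^bsub>Linf\<^esub> T (u(i := a))"
    unfolding T_def by (simp only: D_smult linf.smult_mult[OF e_closed])
qed

text \<open>Each difference of terms is split into a change of the first variable and a change of
  the product of the others. The first part is summed with the l1 distance, the second with the l1
  norm of \<open>u 1\<close>; in both the other factors are estimated uniformly in
  \<open>m\<close>.\<close>

lemma D_diff_le:
  assumes u: "u \<in> P" and v: "v \<in> P" and R: "1 \<le> R" and \<delta>: "0 \<le> \<delta>"
    and u1: "vnorm (E 1) (u 1) \<le> R"
    and uv1: "seq_norm (\<lambda>m. {..m}) (\<lambda>m. the_inv g (u 1) m - the_inv g (v 1) m) \<le> \<delta>"
    and uR: "\<forall>i\<in>{2..n}. \<forall>m. norm (the_inv g (u i) m) \<le> R \<and> norm (the_inv g (v i) m) \<le> R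
               \<and> norm (the_inv g (u i) m - the_inv g (v i) m) \<le> \<delta>"
  shows "norm (D u - D v) \<le> R ^ n * (1 + R * n) * \<delta>"
proof -
  let ?x = "\<lambda>i m. the_inv g (u i) m" and ?y = "\<lambda>i m. the_inv g (v i) m"
  let ?S = "\<lambda>m::nat. {..m}"
  define C where "C = R ^ n"
  have card: "card {2..n} = n - 1" by simp
  have RC: "R ^ (n - 1) \<le> C" unfolding C_def using R by (intro power_increasing) auto
  have C0: "0 \<le> C" using R by (simp add: C_def)
  have d1: "(\<lambda>m. ?x 1 m - ?y 1 m) \<in> seq_bounded ?S"
    by (rule l1.seq_bounded_diff[OF coord_1[OF u] coord_1[OF v]])
  have py: "norm (\<Prod>i\<in>{2..n}. ?y i m) \<le> C" for m
  proof -
    have "norm (\<Prod>i\<in>{2..n}. ?y i m) \<le> (\<Prod>i\<in>{2..n}. R)"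
      unfolding prod_norm[symmetric] using uR by (intro prod_mono) auto
    then show ?thesis using RC by simp
  qed
  have pd: "norm ((\<Prod>i\<in>{2..n}. ?x i m) - (\<Prod>i\<in>{2..n}. ?y i m)) \<le> C * (n * \<delta>)" for m
  proof -
    have "norm ((\<Prod>i\<in>{2..n}. ?x i m) - (\<Prod>i\<in>{2..n}. ?y i m)) \<le> R ^ (n - 1) * ((n - 1) * \<delta>)"
      using norm_prod_diff_le[of "{2..n}" R \<delta> "\<lambda>i. ?x i m" "\<lambda>i. ?y i m"] R \<delta> uR card by simp
    \<comment> \<open>The product over \<open>{2..n}\<close> has \<open>n - 1\<close> factors; both
      occurrences are rounded up to \<open>n\<close>.\<close>
    also have "\<dots> \<le> C * (n * \<delta>)"
      using RC C0 R \<delta> by (intro mult_mono mult_right_mono) auto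
    finally show ?thesis .
  qed
  have est: "norm ((\<Prod>i=1..n. ?x i m) - (\<Prod>i=1..n. ?y i m))
      \<le> norm (?x 1 m - ?y 1 m) * C + norm (?x 1 m) * (C * (n * \<delta>))" for m
  proof -
    have "(\<Prod>i=1..n. ?x i m) - (\<Prod>i=1..n. ?y i m)
        = (?x 1 m - ?y 1 m) * (\<Prod>i\<in>{2..n}. ?y i m) + ?x 1 m * ((\<Prod>i\<in>{2..n}. ?x i m) - (\<Prod>i\<in>{2..n}. ?y i m))"
      unfolding prod_split by (simp add: algebra_simps)
    then have "norm ((\<Prod>i=1..n. ?x i m) - (\<Prod>i=1..n. ?y i m))
      \<le> norm ((?x 1 m - ?y 1 m) * (\<Prod>i\<in>{2..n}. ?y i m))
        + norm (?x 1 m * ((\<Prod>i\<in>{2..n}. ?x i m) - (\<Prod>i\<in>{2..n}. ?y i m)))"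
      by (simp only: norm_triangle_ineq)
    also have "\<dots> \<le> norm (?x 1 m - ?y 1 m) * C + norm (?x 1 m) * (C * (n * \<delta>))"
      unfolding norm_mult by (intro add_mono mult_left_mono py pd norm_ge_zero)
    finally show ?thesis .
  qed
  have s1: "summable (\<lambda>m. norm (?x 1 m - ?y 1 m) * C)"
    by (rule summable_mult2[OF l1_summable(1)[OF d1]])
  have s2: "summable (\<lambda>m. norm (?x 1 m) * (C * (n * \<delta>)))"
    by (rule summable_mult2[OF l1_summable(1)[OF coord_1[OF u]]])
  have x1: "(\<Sum>m. norm (?x 1 m)) \<le> R"
    using l1_summable(2)[OF coord_1[OF u]] u1 by (simp add: E_def l1.vnorm_X)
  have "D u - D v = (\<Sum>m. (\<Prod>i=1..n. ?x i m) - (\<Prod>i=1..n. ?y i m))"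
    unfolding D_def by (rule suminf_diff[OF summable_D[OF u] summable_D[OF v]])
  also have "norm \<dots> \<le> (\<Sum>m. norm (?x 1 m - ?y 1 m) * C + norm (?x 1 m) * (C * (n * \<delta>)))"
    by (rule norm_suminf_le[OF est summable_add[OF s1 s2]])
  also have "\<dots> = (\<Sum>m. norm (?x 1 m - ?y 1 m)) * C + (\<Sum>m. norm (?x 1 m)) * (C * (n * \<delta>))"
    unfolding suminf_add[OF s1 s2, symmetric]
      suminf_mult2[OF l1_summable(1)[OF d1]] suminf_mult2[OF l1_summable(1)[OF coord_1[OF u]]] ..
  also have "\<dots> \<le> \<delta> * C + R * (C * (n * \<delta>))"
    using l1_summable(2)[OF d1] uv1 x1 C0 \<delta> by (intro add_mono mult_right_mono) auto
  also have "\<dots> = R ^ n * (1 + R * n) * \<delta>" by (simp add: C_def algebra_simps)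
  finally show ?thesis .
qed

lemma vdist_T: "vdist Linf (T u) (T v) = norm (D u - D v)"
proof -
  have cl: "T w \<in> carrier Linf" for w unfolding T_def by (rule linf.smult_closed'[OF e_closed])
  have "\<ominus>\<^bsub>Linf\<^esub> T v = (- 1 * D v) \<odot>\<^bsub>Linf\<^esub> g (unit_seq 0)"
    unfolding linf.minus_eq_smult[OF cl] unfolding T_def linf.smult_mult[OF e_closed] ..
  then have "T u \<ominus>\<^bsub>Linf\<^esub> T v = D u \<odot>\<^bsub>Linf\<^esub> g (unit_seq 0) \<oplus>\<^bsub>Linf\<^esub> (- 1 * D v) \<odot>\<^bsub>Linf\<^esub> g (unit_seq 0)"
    by (simp only: a_minus_def T_def)
  also have "\<dots> = (D u + - 1 * D v) \<odot>\<^bsub>Linf\<^esub> g (unit_seq 0)"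
    by (rule linf.smult_add[OF e_closed, symmetric])
  finally have "vnorm Linf (T u \<ominus>\<^bsub>Linf\<^esub> T v) = norm (D u + - 1 * D v) * vnorm Linf (g (unit_seq 0))"
    by (simp only: linf.vnorm_smult[OF e_closed])
  then show ?thesis using cl by (simp add: vdist_def vnorm_e)
qed

lemma continuous_T: "continuous_map (product_topology (\<lambda>i. vtopology (E i)) {1..n}) (vtopology Linf) T"
proof -
  interpret FM: Metric_space "carrier Linf" "vdist Linf" by (rule linf.Metric_space_vdist)
  have MS: "Metric_space (carrier (E i)) (vdist (E i))" for i
    by (rule normed_vs.Metric_space_vdist[OF normed_E])
  have top: "topspace (vtopology (E i)) = carrier (E i)" for i
    using Metric_space.topspace_mtopology[OF MS] by (simp add: vtopology_def)
  have "continuous_map (product_topology (\<lambda>i. vtopology (E i)) {1..n}) FM.mtopology T"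
    unfolding FM.continuous_map_to_metric
  proof (intro ballI allI impI)
    fix u and \<epsilon> :: real assume "u \<in> topspace (product_topology (\<lambda>i. vtopology (E i)) {1..n})" and \<epsilon>: "\<epsilon> > 0"
    then have u: "u \<in> P" by (simp add: top)
    have ui: "u i \<in> carrier (E i)" if "i \<in> {1..n}" for i using u that by auto
    have nn: "0 \<le> vnorm (E i) (u i)" if "i \<in> {1..n}" for i
      by (rule normed_vs.vnorm_nonneg[OF normed_E ui[OF that]])
    \<comment> \<open>The summand 1 leaves room for \<open>v\<close>, whose coordinates differ from
      those of \<open>u\<close> by at most \<open>\<delta> \<le> 1\<close>.\<close>
    define R where "R = 1 + (\<Sum>i=1..n. vnorm (E i) (u i))"
    have R: "1 \<le> R" unfolding R_def using sum_nonneg[of "{1..n}" "\<lambda>i. vnorm (E i) (u i)", OF nn] by simp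
    have uR: "vnorm (E i) (u i) \<le> R - 1" if "i \<in> {1..n}" for i
      unfolding R_def using member_le_sum[OF that, of "\<lambda>i. vnorm (E i) (u i)"] nn by simp
    define K where "K = R ^ n * (1 + R * n)"
    have K: "0 < K" using R by (auto simp: K_def intro!: mult_pos_pos add_pos_nonneg)
    \<comment> \<open>The factor 2 gives \<open>K * \<delta> \<le> \<epsilon> / 2\<close>, hence the
      strict inequality.\<close>
    define \<delta> where "\<delta> = min 1 (\<epsilon> / (2 * K))"
    have \<delta>: "0 < \<delta>" "\<delta> \<le> 1" "K * \<delta> < \<epsilon>"
    proof -
      show "0 < \<delta>" "\<delta> \<le> 1" using \<epsilon> K by (auto simp: \<delta>_def)
      have "K * \<delta> \<le> K * (\<epsilon> / (2 * K))" using K by (intro mult_left_mono) (auto simp: \<delta>_def)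
      also have "\<dots> = \<epsilon> / 2" using K by simp
      finally show "K * \<delta> < \<epsilon>" using \<epsilon> by simp
    qed
    define B where "B i = Metric_space.mball (carrier (E i)) (vdist (E i)) (u i) \<delta>" for i
    have "openin (product_topology (\<lambda>i. vtopology (E i)) {1..n}) (Pi\<^sub>E {1..n} B)"
      unfolding B_def vtopology_def
      by (rule openin_PiE[THEN iffD2]) (auto intro: Metric_space.openin_mball[OF MS])
    moreover have "u \<in> Pi\<^sub>E {1..n} B"
      using u \<delta>(1) by (auto simp: PiE_iff B_def Metric_space.centre_in_mball_iff[OF MS])
    moreover have "T v \<in> FM.mball (T u) \<epsilon>" if v: "v \<in> Pi\<^sub>E {1..n} B" for v
    proof -
      have vB: "v i \<in> carrier (E i)" "vdist (E i) (u i) (v i) < \<delta>" if "i \<in> {1..n}" for i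
        using PiE_mem[OF v that] by (auto simp: B_def Metric_space.in_mball[OF MS])
      have vP: "v \<in> P" using v vB(1) by (auto simp: PiE_iff)
      have one: "1 \<in> {1..n}" using n_pos by simp
      have "norm (D u - D v) \<le> R ^ n * (1 + R * n) * \<delta>"
      proof (rule D_diff_le[OF u vP R less_imp_le[OF \<delta>(1)]])
        show "vnorm (E 1) (u 1) \<le> R" using uR[OF one] by simp
        show "seq_norm (\<lambda>m. {..m}) (\<lambda>m. the_inv g (u 1) m - the_inv g (v 1) m) \<le> \<delta>"
          using vB[OF one] ui[OF one] by (simp add: E_def l1.vdist_X)
        show "\<forall>i\<in>{2..n}. \<forall>m. norm (the_inv g (u i) m) \<le> R \<and> norm (the_inv g (v i) m) \<le> R
               \<and> norm (the_inv g (u i) m - the_inv g (v i) m) \<le> \<delta>"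
        proof (intro ballI allI)
          fix i m assume i2: "i \<in> {2..n}"
          then have i: "i \<in> {1..n}" and Ei: "E i = Linf" by (auto simp: E_def)
          have x: "norm (the_inv g (u i) m) \<le> R - 1" using coord_le[OF ui[OF i], of m] uR[OF i] by simp
          have "(\<lambda>m. the_inv g (u i) m - the_inv g (v i) m) \<in> seq_bounded (\<lambda>m. {m})"
            using ui[OF i] vB(1)[OF i] unfolding Ei linf.carrier_X
            by (auto intro!: linf.seq_bounded_diff)
          from linf.norm_le_seq_norm[OF this, of m]
          have d: "norm (the_inv g (u i) m - the_inv g (v i) m) \<le> \<delta>"
            using vB(2)[OF i] linf.vdist_X[of "u i" "v i"] ui[OF i] vB(1)[OF i] by (simp add: Ei)
          have "norm (the_inv g (v i) m) \<le> norm (the_inv g (u i) m) + norm (the_inv g (u i) m - the_inv g (v i) m)"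
            by (metis norm_minus_commute norm_triangle_sub)
          with x d \<delta>(2) show "norm (the_inv g (u i) m) \<le> R \<and> norm (the_inv g (v i) m) \<le> R
               \<and> norm (the_inv g (u i) m - the_inv g (v i) m) \<le> \<delta>" by simp
        qed
      qed
      then have "vdist Linf (T u) (T v) < \<epsilon>"
        using \<delta>(3) by (simp add: vdist_T K_def)
      moreover have "T w \<in> carrier Linf" for w unfolding T_def by (rule linf.smult_closed'[OF e_closed])
      ultimately show ?thesis by simp
    qed
    ultimately show "\<exists>U. openin (product_topology (\<lambda>i. vtopology (E i)) {1..n}) U \<and> u \<in> U \<and> (\<forall>v\<in>U. T v \<in> FM.mball (T u) \<epsilon>)"
      by blast
  qed
  then show ?thesis by (simp add: vtopology_def)
qed

section \<open>Rank one and the lower bound for cotype exponents\<close>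

lemma unit_in_E: "g (unit_seq j) \<in> carrier (E i)"
  by (simp add: E_def l1.carrier_X linf.carrier_X unit_seq_l1 unit_seq_linf)

lemma T_unit: "T (\<lambda>i\<in>{1..n}. g (unit_seq j)) = g (unit_seq 0)"
proof -
  have "(\<Prod>i=1..n. the_inv g ((\<lambda>i\<in>{1..n}. g (unit_seq j)) i) m) = (if m = j then 1 else 0 :: 'k)" for m
    using n_pos by (simp add: unit_seq_def power_0_left)
  then have "D (\<lambda>i\<in>{1..n}. g (unit_seq j)) = (\<Sum>m. if m = j then 1 else 0)"
    unfolding D_def by simp
  also have "\<dots> = 1" using sums_single[of j "\<lambda>_. 1 :: 'k"] by (simp add: sums_iff)
  finally show ?thesis by (simp only: T_def linf.smult_one'[OF e_closed])
qed

lemma finite_rank_T: "finite_rank n E Linf T"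
  unfolding finite_rank_def
proof (intro exI conjI)
  show "finite {g (unit_seq 0)}" "{g (unit_seq 0)} \<subseteq> carrier Linf" using e_closed by auto
  show "lin_span Linf (T ` P) = lin_span Linf {g (unit_seq 0)}"
  proof
    have "T ` P \<subseteq> lin_span Linf {g (unit_seq 0)}"
    proof
      fix w assume "w \<in> T ` P"
      then obtain u where w: "w = D u \<odot>\<^bsub>Linf\<^esub> g (unit_seq 0)" by (auto simp: T_def)
      show "w \<in> lin_span Linf {g (unit_seq 0)}"
        unfolding lin_span_def hull_def
      proof (rule InterI)
        fix H assume "H \<in> {t. submodule t scalars Linf \<and> {g (unit_seq 0)} \<subseteq> t}"
        then have H: "submodule H scalars Linf" "g (unit_seq 0) \<in> H" by auto
        show "w \<in> H" unfolding w by (rule linf.submoduleE(4)[OF H(1) carrier_scalars H(2)])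
      qed
    qed
    then have "lin_span Linf (T ` P) \<subseteq> lin_span Linf (lin_span Linf {g (unit_seq 0)})"
      unfolding lin_span_def by (rule hull_mono)
    then show "lin_span Linf (T ` P) \<subseteq> lin_span Linf {g (unit_seq 0)}"
      unfolding lin_span_def hull_hull .
    have "(\<lambda>i\<in>{1..n}. g (unit_seq 0)) \<in> P" using unit_in_E by auto
    from imageI[OF this, of T] have "{g (unit_seq 0)} \<subseteq> T ` P" unfolding T_unit by simp
    then show "lin_span Linf {g (unit_seq 0)} \<subseteq> lin_span Linf (T ` P)"
      unfolding lin_span_def by (rule hull_mono)
  qed
qed

text \<open>Testing on the first \<open>k\<close> unit vectors gives
  \<open>k powr (1 / q) \<le> M * k\<close> for every \<open>k\<close>. For \<open>q < 1\<close> the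
  exponent \<open>1 / q - 1\<close> is positive, so no \<open>M\<close> can serve all
  \<open>k\<close>.\<close>

lemma cotype_T_imp_ge_1:
  assumes "has_cotype q n E Linf T"
  shows "1 \<le> q"
proof (rule ccontr)
  assume "\<not> 1 \<le> q"
  obtain M where q: "0 < q" and M: "0 < M"
    and le: "\<And>k x. k \<ge> 1 \<Longrightarrow> (\<forall>i\<in>{1..n}. \<forall>j\<in>{1..k}. x i j \<in> carrier (E i)) \<Longrightarrow>
        (\<Sum>j=1..k. vnorm Linf (T (\<lambda>i\<in>{1..n}. x i j)) powr q) powr (1 / q)
          \<le> M * (\<Prod>i=1..n. rad_norm (E i) k (x i))"
  proof -
    from assms[unfolded has_cotype_def] obtain M where q: "0 < q" and M: "0 < M"
      and "\<forall>k\<ge>1. \<forall>x. (\<forall>i\<in>{1..n}. \<forall>j\<in>{1..k}. x i j \<in> carrier (E i)) \<longrightarrow>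
        (\<Sum>j=1..k. vnorm Linf (T (\<lambda>i\<in>{1..n}. x i j)) powr q) powr (1 / q)
          \<le> M * (\<Prod>i=1..n. rad_norm (E i) k (x i))"
      by blast
    from that[OF q M this(3)[rule_format]] show thesis by blast
  qed
  have bound: "real k powr (1 / q - 1) \<le> M" if k: "k \<ge> 1" for k
  proof -
    have "(\<Prod>i=1..n. rad_norm (E i) k (\<lambda>j. g (unit_seq j))) \<le> (\<Prod>i=1..n. if i = 1 then real k else 1)"
    proof (rule prod_mono, intro conjI)
      fix i
      show "0 \<le> rad_norm (E i) k (\<lambda>j. g (unit_seq j))"
        by (rule normed_vs.rad_norm_nonneg[OF normed_E unit_in_E])
      show "rad_norm (E i) k (\<lambda>j. g (unit_seq j)) \<le> (if i = 1 then real k else 1)"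
        using rad_norm_l1_unit_seq[OF inj_g] rad_norm_linf_unit_seq[OF inj_g] by (simp add: E_def)
    qed
    also have "\<dots> = real k" using n_pos by (simp add: prod.delta)
    finally have prod: "(\<Prod>i=1..n. rad_norm (E i) k (\<lambda>j. g (unit_seq j))) \<le> real k" .
    have "real k powr (1 / q) = (\<Sum>j=1..k. vnorm Linf (T (\<lambda>i\<in>{1..n}. g (unit_seq j))) powr q) powr (1 / q)"
      unfolding T_unit vnorm_e by simp
    also have "\<dots> \<le> M * (\<Prod>i=1..n. rad_norm (E i) k (\<lambda>j. g (unit_seq j)))"
      by (rule le[OF k, of "\<lambda>i j. g (unit_seq j)"]) (simp add: unit_in_E)
    also have "\<dots> \<le> M * real k" using prod M by (intro mult_left_mono) auto
    finally have "real k powr (1 / q) / real k \<le> M" using k by (simp add: divide_le_eq)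
    then show ?thesis using k by (simp add: powr_diff)
  qed
  define \<alpha> where "\<alpha> = 1 / q - 1"
  have \<alpha>: "0 < \<alpha>" using q \<open>\<not> 1 \<le> q\<close> by (simp add: \<alpha>_def field_simps)
  \<comment> \<open>Large enough for \<open>k powr \<alpha>\<close> to exceed the cotype constant by
    1.\<close>
  obtain k :: nat where k: "(M + 1) powr (1 / \<alpha>) \<le> real k" using real_arch_simple by blast
  have "1 \<le> (M + 1) powr (1 / \<alpha>)" using M \<alpha> by (intro ge_one_powr_ge_zero) auto
  then have k1: "k \<ge> 1" using k by linarith
  have "M + 1 = ((M + 1) powr (1 / \<alpha>)) powr \<alpha>" using M \<alpha> by (simp add: powr_powr)
  also have "\<dots> \<le> real k powr \<alpha>" using k \<alpha> by (intro powr_mono2) auto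
  also have "\<dots> \<le> M" using bound[OF k1] by (simp add: \<alpha>_def)
  finally show False by simp
qed

end

section \<open>The characterization\<close>

theorem proposition2p4:
  shows
    "(\<forall>n\<ge>2. \<forall>(E :: nat \<Rightarrow> ('k::rc_field, 'a) nvs) (F :: ('k, 'a) nvs) T.
        (\<forall>i\<in>{1..n}. banach_space (E i)) \<longrightarrow> banach_space F \<longrightarrow>
        T \<in> continuous_multilinear_ops n E F \<longrightarrow> finite_rank n E F T \<longrightarrow>
        has_cotype 1 n E F T) \<and>
     ((UNIV :: real set) \<lesssim> (UNIV :: 'a set) \<longrightarrow>
      (\<forall>n\<ge>1.
        (\<forall>(E :: nat \<Rightarrow> ('k, 'a) nvs) (F :: ('k, 'a) nvs) T.
           (\<forall>i\<in>{1..n}. banach_space (E i)) \<longrightarrow> banach_space F \<longrightarrow>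
           T \<in> continuous_multilinear_ops n E F \<longrightarrow> finite_rank n E F T \<longrightarrow>
           (\<forall>q. proper_cotype n q \<longrightarrow> has_cotype q n E F T))
        \<longleftrightarrow> n = 1 \<or> n = 2))"
proof (intro conjI allI impI)
  fix n :: nat and E :: "nat \<Rightarrow> ('k, 'a) nvs" and F :: "('k, 'a) nvs" and T
  assume "2 \<le> n" "\<forall>i\<in>{1..n}. banach_space (E i)" "banach_space F"
    "T \<in> continuous_multilinear_ops n E F" "finite_rank n E F T"
  then show "has_cotype 1 n E F T"
    by (intro finite_rank_cotype_1) (auto simp: banach_space_def)
next
  fix n :: nat
  assume real_le: "(UNIV :: real set) \<lesssim> (UNIV :: 'a set)" and n: "1 \<le> n"
  show "(\<forall>(E :: nat \<Rightarrow> ('k, 'a) nvs) (F :: ('k, 'a) nvs) T.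
           (\<forall>i\<in>{1..n}. banach_space (E i)) \<longrightarrow> banach_space F \<longrightarrow>
           T \<in> continuous_multilinear_ops n E F \<longrightarrow> finite_rank n E F T \<longrightarrow>
           (\<forall>q. proper_cotype n q \<longrightarrow> has_cotype q n E F T))
        \<longleftrightarrow> n = 1 \<or> n = 2" (is "?all \<longleftrightarrow> _")
  proof
    assume all: ?all
    from lepoll_trans[OF sequences_lepoll_reals real_le]
    obtain g :: "(nat \<Rightarrow> 'k) \<Rightarrow> 'a" where g: "inj g" unfolding lepoll_def by blast
    interpret diagonal_form g n using g n by unfold_locales
    have "T \<in> continuous_multilinear_ops n E Linf"
      unfolding continuous_multilinear_ops_def using multilinear_T continuous_T by simp
    \<comment> \<open>The least proper exponent is the one to test: cotype of the diagonal operator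
      forces it to be at least 1.\<close>
    then have "has_cotype (2 / real n) n E Linf T"
      using all[THEN spec[of _ E], THEN spec[of _ Linf], THEN spec[of _ T]]
        banach_E linf.banach_space_X finite_rank_T by (simp add: proper_cotype_def)
    then have "1 \<le> 2 / real n" by (rule cotype_T_imp_ge_1)
    then have "n \<le> 2" using n by (simp add: field_simps)
    then show "n = 1 \<or> n = 2" using n by auto
  next
    assume "n = 1 \<or> n = 2"
    then show ?all
    proof (intro allI impI)
      fix E :: "nat \<Rightarrow> ('k, 'a) nvs" and F :: "('k, 'a) nvs" and T q
      assume E: "\<forall>i\<in>{1..n}. banach_space (E i)" and F: "banach_space F"
        and T: "T \<in> continuous_multilinear_ops n E F" and fr: "finite_rank n E F T"
        and q: "proper_cotype n q"
      have E': "normed_vs (E i)" if "i \<in> {1..n}" for i using E that by (simp add: banach_space_def)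
      have F': "normed_vs F" using F by (simp add: banach_space_def)
      have lin: "multilinear_op n E F T" using T by (simp add: continuous_multilinear_ops_def)
      \<comment> \<open>The exponents 2 and 1 proved for degrees 1 and 2 are exactly
        \<open>2 / n\<close>; monotonicity gives all larger ones.\<close>
      from \<open>n = 1 \<or> n = 2\<close> show "has_cotype q n E F T"
      proof
        assume n1: "n = 1"
        have "has_cotype 2 1 E F T"
          by (rule finite_rank_cotype_2[OF _ F']) (use E' T fr n1 in auto)
        then show ?thesis
          using has_cotype_mono[OF F' lin, of 2 q] q n1 by (simp add: proper_cotype_def)
      next
        assume n2: "n = 2"
        have "has_cotype 1 n E F T"
          by (rule finite_rank_cotype_1[OF _ E' F' T fr]) (use n2 in auto)
        then show ?thesis
          using has_cotype_mono[OF F' lin, of 1 q] q n2 by (simp add: proper_cotype_def)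
      qed
    qed
  qed
qed

end
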